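(* Let $X$ be a compact metric space, $\nu$ a non-atomic Borel probability measure on $X$ such that every ball has positive $\nu$-measure, and $\tau:X\to X$ a $\nu$-preserving transformation. Then for every hyperfinite approximation $Y\subseteq{}^*X$ of the measure space $(X,\nu)$ there exists an internal permutation $T:Y\to Y$ such that $(Y,\mu_L,T)$ is a hyperfinite approximation of the dynamical system $(X,\nu,\tau)$. Moreover, $T$ can be chosen to be a transitive permutation.
   Context: We work in an $\aleph_1$-saturated nonstandard universe. For compact metric $X$, $\mathrm{st}:{}^*X\to X$ is the standard part map ($\mathrm{st}(\xi)\approx\xi$, i.e. the extended distance between them is infinitesimal); we write ${}^\circ y=\mathrm{st}(y)$. For a hyperfinite set $Y$, $\mu_L$ is the Loeb measure on $Y$ obtained from the normalized counting measure $B\mapsto{}^\circ(|B|/|Y|)$ on internal subsets $B\subseteq Y$ (extended to the generated $\sigma$-algebra and completed). A hyperfinite set $Y\subseteq{}^*X$ is a hyperfinite approximation of $(X,\nu)$ if $\mathrm{st}\upharpoonright Y:Y\to X$ is measure preserving from $(Y,\mu_L)$ to $(X,\nu)$. If $Y$ is such, and $T:Y\to Y$ is an internal permutation, then $T$ is a hyperfinite approximation of $\tau$, and $(Y,\mu_L,T)$ is a hyperfinite approximation of the dynamical system $(X,\nu,\tau)$, if $T(y)\approx\tau({}^\circ y)$ for $\mu_L$-almost all $y\in Y$ (i.e. $T$ is a lifting of $\tau$). An internal permutation $T$ of $Y$ is transitive if it is a single cycle of length $|Y|$, i.e. the (internal) orbit of some (equivalently, every) element of $Y$ has $|Y|$ elements.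 *)

theory Defs
  imports "HOL-Probability.Probability"
begin

section \<open>Bounded formulas\<close>

text \<open>
  Bounded formulas of the language of set theory. Variables are numbers;
  \<open>BAll v b \<phi>\<close> is \<open>\<forall>x\<^sub>v \<in> x\<^sub>b. \<phi>\<close>. Constants for standard entities are
  provided by the assignment of the free variables.
\<close>

datatype bformula =
    Mem nat nat
  | Eq nat nat
  | Neg bformula
  | Conj bformula bformula
  | BAll nat nat bformula

primrec sat :: "('m \<Rightarrow> 'm \<Rightarrow> bool) \<Rightarrow> (nat \<Rightarrow> 'm) \<Rightarrow> bformula \<Rightarrow> bool" where
  "sat E e (Mem i j) \<longleftrightarrow> E (e i) (e j)"
| "sat E e (Eq i j) \<longleftrightarrow> e i = e j"
| "sat E e (Neg \<phi>) \<longleftrightarrow> \<not> sat E e \<phi>"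
| "sat E e (Conj \<phi> \<psi>) \<longleftrightarrow> sat E e \<phi> \<and> sat E e \<psi>"
| "sat E e (BAll v b \<phi>) \<longleftrightarrow> (\<forall>x. E x (e b) \<longrightarrow> sat E (e(v := x)) \<phi>)"


section \<open>Nonstandard universes\<close>

text \<open>
  A nonstandard universe consists of a superstructure on a base set \<open>base U\<close> of atoms
  (carried by \<^typ>\<open>'u\<close>, with membership \<open>mem U\<close>), a second universe carried by \<^typ>\<open>'w\<close>
  (with membership \<open>nmem U\<close>), and the embedding \<open>star U\<close> of the first into the second.
  The points of the metric space (the type \<^typ>\<open>'a\<close>) and the real numbers are
  atoms via \<open>pt U\<close> and \<open>re U\<close>; the images of these two maps may overlap, and there may be
  further atoms.
\<close>

record ('a, 'u, 'w) universe =
  base :: "'u set"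
  mem :: "'u \<Rightarrow> 'u \<Rightarrow> bool"
  pt :: "'a \<Rightarrow> 'u"
  re :: "real \<Rightarrow> 'u"
  nmem :: "'w \<Rightarrow> 'w \<Rightarrow> bool"
  star :: "'u \<Rightarrow> 'w"

primrec level :: "('a, 'u, 'w) universe \<Rightarrow> nat \<Rightarrow> 'u set" where
  "level U 0 = base U"
| "level U (Suc n) = base U \<union> {x. x \<notin> base U \<and> {z. mem U z x} \<subseteq> level U n}"

text \<open>
  If the last clause holds for all \<open>n\<close>, this says that \<^typ>\<open>'u\<close> is (isomorphic to) the full
  superstructure \<open>V(S) = (\<Union>n. V\<^sub>n(S))\<close> over \<open>S = base U\<close>, where \<open>V\<^sub>0(S) = S\<close> and
  \<open>V\<^sub>n\<^sub>+\<^sub>1(S) = V\<^sub>n(S) \<union> Pow (V\<^sub>n(S))\<close>. The types of HOL do not provably go as high as \<open>V(S)\<close>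
  (in the standard model of HOL no type is that large), so only the sets of rank at most
  \<open>N\<close> are required to be there; for instance \<open>V\<^sub>N(S)\<close> itself is allowed.
\<close>

definition superstructure :: "nat \<Rightarrow> ('a, 'u, 'w) universe \<Rightarrow> bool" where
  "superstructure N U \<longleftrightarrow>
     (\<forall>x\<in>base U. \<forall>z. \<not> mem U z x) \<and>
     (\<forall>x y. x \<notin> base U \<longrightarrow> y \<notin> base U \<longrightarrow> {z. mem U z x} = {z. mem U z y} \<longrightarrow> x = y) \<and>
     (\<forall>x. \<exists>n. x \<in> level U n) \<and>
     (\<forall>n<N. \<forall>A. A \<subseteq> level U n \<longrightarrow> (\<exists>x. x \<notin> base U \<and> {z. mem U z x} = A))"

text \<open>The standard set with the given elements.\<close>

definition set_of :: "('a, 'u, 'w) universe \<Rightarrow> 'u set \<Rightarrow> 'u" where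
  "set_of U A = (THE x. x \<notin> base U \<and> {z. mem U z x} = A)"

definition ext :: "('a, 'u, 'w) universe \<Rightarrow> 'w \<Rightarrow> 'w set" where
  "ext U w = {v. nmem U v w}"

definition internal :: "('a, 'u, 'w) universe \<Rightarrow> 'w \<Rightarrow> bool" where
  "internal U w \<longleftrightarrow> (\<exists>a. w \<in> ext U (star U a))"

definition internal_set :: "('a, 'u, 'w) universe \<Rightarrow> 'w \<Rightarrow> bool" where
  "internal_set U w \<longleftrightarrow> internal U w \<and> w \<notin> ext U (star U (set_of U (base U)))"

definition transfer_principle :: "('a, 'u, 'w) universe \<Rightarrow> bool" where
  "transfer_principle U \<longleftrightarrow>
     (\<forall>\<phi> e. sat (mem U) e \<phi> \<longleftrightarrow> sat (nmem U) (\<lambda>i. star U (e i)) \<phi>)"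

definition aleph1_saturated :: "('a, 'u, 'w) universe \<Rightarrow> bool" where
  "aleph1_saturated U \<longleftrightarrow>
     (\<forall>F. countable F \<longrightarrow> (\<forall>A\<in>F. internal_set U A) \<longrightarrow>
        (\<forall>G. finite G \<longrightarrow> G \<subseteq> F \<longrightarrow> (\<Inter>A\<in>G. ext U A) \<noteq> {}) \<longrightarrow>
        (\<Inter>A\<in>F. ext U A) \<noteq> {})"

text \<open>
  All standard sets and functions used below, and routine auxiliary ones, have rank well
  below 20; every actual superstructure satisfies \<open>superstructure N\<close> for all \<open>N\<close>.
  That \<open>star U\<close> is not onto already follows from saturation.
\<close>

definition aleph1_saturated_universe :: "('a, 'u, 'w) universe \<Rightarrow> bool" where
  "aleph1_saturated_universe U \<longleftrightarrow>
     superstructure 20 U \<and>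
     inj (pt U) \<and> range (pt U) \<subseteq> base U \<and>
     inj (re U) \<and> range (re U) \<subseteq> base U \<and>
     transfer_principle U \<and> aleph1_saturated U"


section \<open>Pairs and functions inside the two universes\<close>

definition pair :: "('a, 'u, 'w) universe \<Rightarrow> 'u \<Rightarrow> 'u \<Rightarrow> 'u" where
  "pair U x y = set_of U {set_of U {x}, set_of U {x, y}}"

text \<open>\<open>p\<close> is the Kuratowski pair of \<open>x\<close> and \<open>y\<close> in the nonstandard universe.\<close>

definition is_npair :: "('a, 'u, 'w) universe \<Rightarrow> 'w \<Rightarrow> 'w \<Rightarrow> 'w \<Rightarrow> bool" where
  "is_npair U p x y \<longleftrightarrow> (\<exists>a b. ext U p = {a, b} \<and> ext U a = {x} \<and> ext U b = {x, y})"

definition nrel :: "('a, 'u, 'w) universe \<Rightarrow> 'w \<Rightarrow> 'w \<Rightarrow> 'w \<Rightarrow> bool" where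
  "nrel U R x y \<longleftrightarrow> (\<exists>p\<in>ext U R. is_npair U p x y)"

definition napp :: "('a, 'u, 'w) universe \<Rightarrow> 'w \<Rightarrow> 'w \<Rightarrow> 'w" where
  "napp U f x = (THE y. nrel U f x y)"

definition napp2 :: "('a, 'u, 'w) universe \<Rightarrow> 'w \<Rightarrow> 'w \<Rightarrow> 'w \<Rightarrow> 'w" where
  "napp2 U f x y = (THE z. \<exists>q. is_npair U q x y \<and> nrel U f q z)"


section \<open>Hyperreals and the nonstandard extension of the metric space\<close>

definition less_rel :: "('a, 'u, 'w) universe \<Rightarrow> 'u" where
  "less_rel U = set_of U {pair U (re U a) (re U b) | a b. a < b}"

definition div_fun :: "('a, 'u, 'w) universe \<Rightarrow> 'u" where
  "div_fun U = set_of U {pair U (pair U (re U a) (re U b)) (re U (a / b)) | a b. True}"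

definition dist_fun :: "('a::metric_space, 'u, 'w) universe \<Rightarrow> 'u" where
  "dist_fun U = set_of U {pair U (pair U (pt U x) (pt U y)) (re U (dist x y)) | x y. True}"

text \<open>The hyperreal \<open>q\<close> is infinitely close to the standard real \<open>r\<close>.\<close>

definition near_real :: "('a, 'u, 'w) universe \<Rightarrow> 'w \<Rightarrow> real \<Rightarrow> bool" where
  "near_real U q r \<longleftrightarrow>
     (\<forall>\<epsilon>>0. nrel U (star U (less_rel U)) (star U (re U (r - \<epsilon>))) q \<and>
            nrel U (star U (less_rel U)) q (star U (re U (r + \<epsilon>))))"

definition st_real :: "('a, 'u, 'w) universe \<Rightarrow> 'w \<Rightarrow> real" where
  "st_real U q = (THE r. near_real U q r)"

text \<open>For \<open>\<xi>, \<eta>\<close> in the nonstandard extension of the metric space.\<close>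

definition near :: "('a::metric_space, 'u, 'w) universe \<Rightarrow> 'w \<Rightarrow> 'w \<Rightarrow> bool" where
  "near U \<xi> \<eta> \<longleftrightarrow> near_real U (napp2 U (star U (dist_fun U)) \<xi> \<eta>) 0"

definition st :: "('a::metric_space, 'u, 'w) universe \<Rightarrow> 'w \<Rightarrow> 'a" where
  "st U \<xi> = (THE x. near U \<xi> (star U (pt U x)))"


section \<open>Hyperfinite sets and Loeb measure\<close>

definition fin_sets :: "('a, 'u, 'w) universe \<Rightarrow> 'u" where
  "fin_sets U = set_of U {set_of U (pt U ` F) | F. finite F}"

definition card_fun :: "('a, 'u, 'w) universe \<Rightarrow> 'u" where
  "card_fun U =
     set_of U {pair U (set_of U (pt U ` F)) (re U (real (card F))) | F. finite F}"

text \<open>Hyperfinite subsets of the nonstandard extension of the metric space.\<close>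

definition hyperfinite :: "('a, 'u, 'w) universe \<Rightarrow> 'w \<Rightarrow> bool" where
  "hyperfinite U Y \<longleftrightarrow> Y \<in> ext U (star U (fin_sets U))"

definition ncard :: "('a, 'u, 'w) universe \<Rightarrow> 'w \<Rightarrow> 'w" where
  "ncard U B = napp U (star U (card_fun U)) B"

definition loeb :: "('a, 'u, 'w) universe \<Rightarrow> 'w \<Rightarrow> 'w measure" where
  "loeb U Y = completion (extend_measure (ext U Y)
     {B. internal_set U B \<and> ext U B \<subseteq> ext U Y} (ext U)
     (\<lambda>B. ennreal (st_real U (napp2 U (star U (div_fun U)) (ncard U B) (ncard U Y)))))"


section \<open>Hyperfinite approximations\<close>

definition measure_preserving :: "'b measure \<Rightarrow> 'c measure \<Rightarrow> ('b \<Rightarrow> 'c) \<Rightarrow> bool" where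
  "measure_preserving M N f \<longleftrightarrow> f \<in> measurable M N \<and> distr M N f = N"

definition nonatomic :: "'b measure \<Rightarrow> bool" where
  "nonatomic M \<longleftrightarrow>
     (\<forall>A\<in>sets M. 0 < emeasure M A \<longrightarrow>
        (\<exists>B\<in>sets M. B \<subseteq> A \<and> 0 < emeasure M B \<and> emeasure M B < emeasure M A))"

definition hf_approx_space ::
    "('a::metric_space, 'u, 'w) universe \<Rightarrow> 'a measure \<Rightarrow> 'w \<Rightarrow> bool" where
  "hf_approx_space U \<nu> Y \<longleftrightarrow> hyperfinite U Y \<and> measure_preserving (loeb U Y) \<nu> (st U)"

text \<open>Permutations are internal sets of pairs.\<close>

definition internal_permutation :: "('a, 'u, 'w) universe \<Rightarrow> 'w \<Rightarrow> 'w \<Rightarrow> bool" where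
  "internal_permutation U Y T \<longleftrightarrow>
     internal_set U T \<and>
     (\<forall>p\<in>ext U T. \<exists>x\<in>ext U Y. \<exists>y\<in>ext U Y. is_npair U p x y) \<and>
     (\<forall>x\<in>ext U Y. \<exists>!y. nrel U T x y) \<and>
     bij_betw (napp U T) (ext U Y) (ext U Y)"

definition hf_approx_system ::
    "('a::metric_space, 'u, 'w) universe \<Rightarrow> 'a measure \<Rightarrow> ('a \<Rightarrow> 'a) \<Rightarrow> 'w \<Rightarrow> 'w \<Rightarrow> bool" where
  "hf_approx_system U \<nu> \<tau> Y T \<longleftrightarrow>
     hf_approx_space U \<nu> Y \<and> internal_permutation U Y T \<and>
     (AE y in loeb U Y. near U (napp U T y) (star U (pt U (\<tau> (st U y)))))"

text \<open>
  The standard function taking the graph of a permutation \<open>f\<close> of a finite set \<open>F\<close> of points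
  and an element \<open>x\<close> of \<open>F\<close> to the orbit of \<open>x\<close> under \<open>f\<close>.
\<close>

definition orbit_fun :: "('a, 'u, 'w) universe \<Rightarrow> 'u" where
  "orbit_fun U = set_of U
     {pair U (pair U (set_of U ((\<lambda>z. pair U (pt U z) (pt U (f z))) ` F)) (pt U x))
             (set_of U (pt U ` {(f ^^ k) x | k. True}))
      | F f x. finite F \<and> bij_betw f F F \<and> x \<in> F}"

definition internal_orbit :: "('a, 'u, 'w) universe \<Rightarrow> 'w \<Rightarrow> 'w \<Rightarrow> 'w" where
  "internal_orbit U T y = napp2 U (star U (orbit_fun U)) T y"

definition transitive_permutation :: "('a, 'u, 'w) universe \<Rightarrow> 'w \<Rightarrow> 'w \<Rightarrow> bool" where
  "transitive_permutation U Y T \<longleftrightarrow>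
     internal_permutation U Y T \<and>
     (\<exists>y\<in>ext U Y. ncard U (internal_orbit U T y) = ncard U Y)"

end

theory Submission
  imports Defs "HOL-Combinatorics.Transposition"
begin

text \<open>
  The proof splits into a statement about finite subsets of \<open>X\<close> and its transfer to \<open>Y\<close>.

  Let \<open>F\<close> be a finite set of points whose uniform distribution is close to \<open>\<nu>\<close> in the weak topology.
  Cut \<open>X\<close> into finitely many small Borel pieces. Colour a point \<open>y\<close> of \<open>F\<close> by the piece that
  contains \<open>\<tau> x\<close> for a point \<open>x\<close> near \<open>y\<close>, and colour it, as a target, by the piece that contains a
  point near it. On a closed set of almost full measure both colourings are locally constant (the
  finite-valued case of Lusin's theorem, \<open>lusin_finite_valued\<close>), so they make sense for most of
  \<open>F\<close>. Since \<open>\<tau>\<close> preserves \<open>\<nu>\<close>, a colour has about as many sources as targets, so some permutation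
  \<open>T\<close> of \<open>F\<close> respects colours at most points; then \<open>T y\<close> is close to \<open>\<tau> x\<close> for some \<open>x\<close> near \<open>y\<close>.
  Exchanging the values of \<open>T\<close> at two points of different cycles merges the cycles. It costs nothing
  if the two points have the same source colour, and it is needed for different colours only once
  per colour, so \<open>T\<close> can be made a single cycle (\<open>cyclic_matching\<close>). The cost is negligible because
  \<open>F\<close> is large, \<open>\<nu>\<close> having no atoms. All that is used about \<open>F\<close> is that finitely many open sets
  \<open>S\<close> contain more than \<open>r\<close> times the points of \<open>F\<close>, where \<open>r < \<nu> S\<close>; these conditions form the
  filter \<open>uniform_near \<nu>\<close>, and the result is \<open>eventually_cyclic_permutation\<close>.

  The hyperfinite set \<open>Y\<close> satisfies the star of every condition in this filter: a point whose
  standard part lies in the open set \<open>S\<close> lies in \<open>*S\<close>, so the share of \<open>Y\<close> in \<open>*S\<close> is at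
  least \<open>\<nu> S\<close> up to an infinitesimal (\<open>open_counts\<close>, \<open>star_of_eventually\<close>). By transfer the internal
  set of cyclic permutations of \<open>Y\<close> that meet the first \<open>N\<close> of a sequence of tolerances is nonempty. These sets
  decrease, so saturation provides one \<open>T\<close> that meets all tolerances. The \<open>n\<close>-th tolerance fails on a set of
  Loeb measure at most \<open>2\<^sup>-\<^sup>n\<close>, so by the Borel-Cantelli lemma almost every \<open>y\<close> violates only
  finitely many of them, and \<open>st y\<close> lies in all but finitely many of the sets on which \<open>\<tau>\<close> is
  uniformly continuous at the scale of the tolerance (\<open>lusin_sequence\<close>). This gives
  \<open>T y \<approx> \<tau> (st y)\<close>.

  Transfer is applied to explicit bounded formulas. To keep them short, every finitary notion enters as
  one standard set or relation (\<open>fin_where\<close>, \<open>pt_rel\<close>, \<open>fin_rel\<close>, \<open>perm_rel\<close>), and the simplifier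
  evaluates satisfaction on both sides.
\<close>

section \<open>Cyclic permutations matching two colourings\<close>

definition orbit_of :: "('a \<Rightarrow> 'a) \<Rightarrow> 'a \<Rightarrow> 'a set" where
  "orbit_of f x = {(f ^^ k) x | k. True}"

lemma orbit_of_self: "x \<in> orbit_of f x"
  unfolding orbit_of_def by (rule CollectI, rule exI[of _ 0]) simp

lemma orbit_of_step: "y \<in> orbit_of f x \<Longrightarrow> f y \<in> orbit_of f x"
  unfolding orbit_of_def
proof -
  assume "y \<in> {(f ^^ k) x |k. True}"
  then obtain k where "y = (f ^^ k) x" by blast
  then show "f y \<in> {(f ^^ k) x |k. True}" by (intro CollectI exI[of _ "Suc k"]) simp
qed

lemma orbit_of_least:
  assumes "x \<in> S" "\<And>y. y \<in> S \<Longrightarrow> f y \<in> S"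
  shows "orbit_of f x \<subseteq> S"
proof -
  have "(f ^^ k) x \<in> S" for k
    using assms by (induction k) auto
  then show ?thesis by (auto simp: orbit_of_def)
qed

lemma orbit_of_subset:
  assumes "bij_betw f F F" "x \<in> F"
  shows "orbit_of f x \<subseteq> F"
  using assms by (intro orbit_of_least) (auto dest: bij_betwE)

text \<open>
  An injective map of a finite set into itself is onto, so an invariant subset has no
  preimages outside itself.
\<close>

lemma invariant_complement:
  assumes "finite F" "bij_betw f F F" "S \<subseteq> F" "\<And>y. y \<in> S \<Longrightarrow> f y \<in> S" "y \<in> F" "f y \<in> S"
  shows "y \<in> S"
proof -
  have inj: "inj_on f F" using assms(2) by (simp add: bij_betw_def)
  have "finite S" using assms(1,3) finite_subset by blast
  moreover have "f ` S \<subseteq> S" using assms(4) by blast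
  ultimately have "f ` S = S"
    using inj assms(3) by (meson endo_inj_surj inj_on_subset)
  then obtain s where "s \<in> S" "f s = f y" using assms(6) by (metis imageE)
  then show ?thesis using inj assms(3,5) by (metis inj_onD subsetD)
qed

definition swap_values :: "('a \<Rightarrow> 'b) \<Rightarrow> 'a \<Rightarrow> 'a \<Rightarrow> 'a \<Rightarrow> 'b" where
  "swap_values f y z = f \<circ> Transposition.transpose y z"

lemma swap_values_apply:
  "swap_values f y z x = (if x = z then f y else if x = y then f z else f x)"
  by (simp add: swap_values_def Transposition.transpose_def)

lemma bij_betw_swap_values:
  assumes "bij_betw f F F" "y \<in> F" "z \<in> F"
  shows "bij_betw (swap_values f y z) F F"
  unfolding swap_values_def
  by (rule bij_betw_trans[OF bij_betw_transpose_iff assms(1)]) (simp add: assms)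

text \<open>
  Exchanging the values at a point \<open>y\<close> of the orbit and a point \<open>z\<close> of another cycle splices the cycle of
  \<open>z\<close> into the orbit. The argument avoids following iterates: outside \<open>y\<close> and \<open>z\<close> the two maps agree, so
  the traces of the new orbit on the old orbit and on its complement would be invariant
  under the old map if they missed \<open>y\<close> and \<open>z\<close>, respectively.
\<close>

lemma orbit_of_swap_values:
  assumes fin: "finite F" and f: "bij_betw f F F"
    and x: "x \<in> F" and y: "y \<in> orbit_of f x" and z: "z \<in> F" "z \<notin> orbit_of f x"
  shows "insert z (orbit_of f x) \<subseteq> orbit_of (swap_values f y z) x"
proof -
  let ?O = "orbit_of f x" and ?g = "swap_values f y z"
  let ?O' = "orbit_of ?g x"
  have OF: "?O \<subseteq> F" using orbit_of_subset[OF f x] .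
  have fF: "\<And>u. u \<in> F \<Longrightarrow> f u \<in> F" using f by (auto dest: bij_betwE)
  have yO': "y \<in> ?O'"
  proof (rule ccontr)
    assume n: "y \<notin> ?O'"
    have "?O \<subseteq> ?O \<inter> ?O'"
    proof (rule orbit_of_least)
      fix u assume u: "u \<in> ?O \<inter> ?O'"
      then have "u \<noteq> y" "u \<noteq> z" using n z by auto
      then show "f u \<in> ?O \<inter> ?O'"
        using u orbit_of_step[of u f x] orbit_of_step[of u ?g x] by (simp add: swap_values_apply)
    qed (simp add: orbit_of_self)
    then show False using n y by blast
  qed
  have zO': "z \<in> ?O'"
  proof (rule ccontr)
    assume n: "z \<notin> ?O'"
    let ?R = "F - ?O"
    have step: "f u \<in> ?R" if "u \<in> ?R" for u
    proof -
      have "f u \<in> ?O \<Longrightarrow> u \<in> ?O"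
        using that invariant_complement[OF fin f OF orbit_of_step, of u] by auto
      then show ?thesis using that fF by auto
    qed
    have "f z \<in> ?O'"
      using orbit_of_step[OF yO'] z y by (auto simp: swap_values_apply split: if_splits)
    then have "f z \<in> ?R \<inter> ?O'" using step z by blast
    moreover have "f u \<in> ?R \<inter> ?O'" if u: "u \<in> ?R \<inter> ?O'" for u
    proof -
      have "u \<noteq> y" "u \<noteq> z" using n u y by auto
      then show ?thesis using u step[of u] orbit_of_step[of u ?g x]
        by (simp add: swap_values_apply)
    qed
    ultimately have "z \<in> ?R \<inter> ?O'"
      using invariant_complement[OF fin f, of "?R \<inter> ?O'" z] z(1) by blast
    then show False using n by blast
  qed
  have "?O \<subseteq> ?O'"
  proof (rule orbit_of_least)
    fix u assume "u \<in> ?O'"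
    then show "f u \<in> ?O'"
      using orbit_of_step[of u ?g x] orbit_of_step[OF yO'] orbit_of_step[OF zO']
      by (auto simp: swap_values_apply split: if_splits)
  qed (simp add: orbit_of_self)
  then show ?thesis using zO' by blast
qed

lemma finite_maximal:
  fixes \<mu> :: "'b \<Rightarrow> nat"
  assumes "P a" "\<And>x. P x \<Longrightarrow> \<mu> x \<le> N"
  shows "\<exists>x. P x \<and> (\<forall>y. P y \<longrightarrow> \<mu> y \<le> \<mu> x)"
  using ex_has_greatest_nat[of P a \<mu> "Suc N"] assms by (auto simp: less_Suc_eq_le)

definition matched :: "'a set \<Rightarrow> ('a \<Rightarrow> 'c) \<Rightarrow> ('a \<Rightarrow> 'c) \<Rightarrow> ('a \<Rightarrow> 'a) \<Rightarrow> 'a set" where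
  "matched F b c f = {y \<in> F. b y = c (f y)}"

text \<open>
  A permutation with the largest number of colour matches is good for every colour: a colour that
  falls short has an unmatched source \<open>y\<close> and an unmatched target \<open>f z\<close>, and exchanging the values at
  \<open>y\<close> and \<open>z\<close> would gain a match.
\<close>

lemma exists_matching_permutation:
  assumes fin: "finite F"
  shows "\<exists>f. bij_betw f F F \<and>
    (\<forall>k. min (card {y \<in> F. b y = k}) (card {y \<in> F. c y = k}) \<le> card {y \<in> F. b y = k \<and> c (f y) = k})"
proof -
  obtain f where f: "bij_betw f F F"
    and max: "\<And>g. bij_betw g F F \<Longrightarrow> card (matched F b c g) \<le> card (matched F b c f)"
    using finite_maximal[of "\<lambda>f. bij_betw f F F" id "\<lambda>f. card (matched F b c f)" "card F"] fin
    by (auto simp: matched_def intro: card_mono)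
  have "min (card {y \<in> F. b y = k}) (card {y \<in> F. c y = k}) \<le> card {y \<in> F. b y = k \<and> c (f y) = k}"
    for k
  proof (rule ccontr)
    let ?M = "{y \<in> F. b y = k \<and> c (f y) = k}"
    assume "\<not> ?thesis"
    then have less: "card ?M < card {y \<in> F. b y = k}" "card ?M < card {y \<in> F. c y = k}" by auto
    have "\<not> {y \<in> F. b y = k} \<subseteq> ?M" using less(1) fin card_mono[of ?M "{y \<in> F. b y = k}"] by force
    then obtain y where y: "y \<in> F" "b y = k" "c (f y) \<noteq> k" by blast
    have "card (f ` ?M) \<le> card ?M" using fin card_image_le[of ?M f] by simp
    then have "\<not> {y \<in> F. c y = k} \<subseteq> f ` ?M"
      using less(2) fin card_mono[of "f ` ?M" "{y \<in> F. c y = k}"] by force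
    then obtain w where w: "w \<in> F" "c w = k" "w \<notin> f ` ?M" by blast
    then obtain z where z: "z \<in> F" "w = f z" using f by (metis bij_betw_def imageE)
    have bz: "b z \<noteq> k" using w z by auto
    let ?g = "swap_values f y z"
    have "matched F b c f \<subset> matched F b c ?g"
    proof
      show "matched F b c f \<subseteq> matched F b c ?g"
        using y w z bz unfolding matched_def by (auto simp: swap_values_apply)
      have "y \<in> matched F b c ?g" "y \<notin> matched F b c f"
        using y w z bz by (auto simp: matched_def swap_values_apply)
      then show "matched F b c f \<noteq> matched F b c ?g" by blast
    qed
    then have "card (matched F b c f) < card (matched F b c ?g)"
      using fin by (intro psubset_card_mono) (auto simp: matched_def)
    then show False using max[OF bij_betw_swap_values[OF f y(1) z(1)]] by simp
  qed
  with f show ?thesis by (intro exI[of _ f] conjI allI)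
qed

lemma card_matched_swap_same_colour:
  assumes "y \<in> F" "z \<in> F" "b y = b z"
  shows "card (matched F b c (swap_values f y z)) = card (matched F b c f)"
proof -
  have "matched F b c (swap_values f y z) = Transposition.transpose y z ` matched F b c f"
  proof (rule set_eqI)
    fix x
    show "x \<in> matched F b c (swap_values f y z) \<longleftrightarrow> x \<in> Transposition.transpose y z ` matched F b c f"
    proof (cases "x \<in> {y, z}")
      case True
      then have "b x = b (Transposition.transpose y z x)" "x \<in> F" "Transposition.transpose y z x \<in> F" using assms by auto
      then show ?thesis by (simp add: in_transpose_image_iff matched_def swap_values_def)
    qed (simp add: in_transpose_image_iff matched_def swap_values_def)
  qed
  then show ?thesis by (simp add: card_image)
qed

lemma card_matched_swap:
  assumes "finite F"
  shows "card (matched F b c f) \<le> card (matched F b c (swap_values f y z)) + 2"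
proof -
  have "matched F b c f \<subseteq> matched F b c (swap_values f y z) \<union> {y, z}"
    by (auto simp: matched_def swap_values_apply)
  then have "card (matched F b c f) \<le> card (matched F b c (swap_values f y z) \<union> {y, z})"
    using assms by (intro card_mono) (auto simp: matched_def)
  also have "\<dots> \<le> card (matched F b c (swap_values f y z)) + card {y, z}" by (rule card_Un_le)
  also have "card {y, z} \<le> 2" by (simp add: card_insert_if)
  finally show ?thesis by simp
qed

text \<open>
  Merging cycles by exchanging values at two points of the same colour preserves the number of
  matches, and each exchange at points of different colours loses at most two. The loss is paid for by a new
  colour in the orbit of \<open>x\<close>, so a permutation that maximises this orbit among those
  with controlled loss is a single cycle.
\<close>

lemma exists_cyclic_permutation:
  assumes fin: "finite F" and x: "x \<in> F" and f: "bij_betw f F F"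
  shows "\<exists>T. bij_betw T F F \<and> orbit_of T x = F \<and>
    card (matched F b c f) \<le> card (matched F b c T) + 2 * card (b ` F)"
proof -
  (* Two matches may be lost for every colour that the orbit of x has already met. *)
  define P where "P g \<longleftrightarrow> bij_betw g F F \<and>
    card (matched F b c f) \<le> card (matched F b c g) + 2 * card (b ` orbit_of g x)" for g
  have "card (orbit_of g x) \<le> card F" if "P g" for g
    using that orbit_of_subset[of g F x] x fin by (auto simp: P_def intro!: card_mono)
  then obtain T where T: "P T" and max: "\<And>g. P g \<Longrightarrow> card (orbit_of g x) \<le> card (orbit_of T x)"
    using finite_maximal[of P f "\<lambda>g. card (orbit_of g x)" "card F"] f by (auto simp: P_def)
  let ?O = "orbit_of T x"
  have bij: "bij_betw T F F" using T by (simp add: P_def)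
  have OF: "?O \<subseteq> F" using orbit_of_subset[OF bij x] .
  have contra: "\<not> P (swap_values T y z)" if "y \<in> ?O" "z \<in> F" "z \<notin> ?O" for y z
  proof
    assume P: "P (swap_values T y z)"
    have sub: "insert z ?O \<subseteq> orbit_of (swap_values T y z) x"
      using orbit_of_swap_values[OF fin bij x that] .
    have "orbit_of (swap_values T y z) x \<subseteq> F" using P x orbit_of_subset unfolding P_def by metis
    then have "card (insert z ?O) \<le> card (orbit_of (swap_values T y z) x)"
      using sub fin by (meson card_mono finite_subset)
    moreover have "card (insert z ?O) = Suc (card ?O)"
      using that fin OF by (simp add: finite_subset)
    ultimately show False using max[OF P] by simp
  qed
  have "?O = F"
  proof (rule ccontr)
    assume "?O \<noteq> F"
    then obtain z0 where z0: "z0 \<in> F" "z0 \<notin> ?O" using OF by blast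
    have finO': "finite (b ` orbit_of (swap_values T y z) x)" if "y \<in> F" "z \<in> F" for y z
      using orbit_of_subset[OF bij_betw_swap_values[OF bij that] x] fin
      by (meson finite_imageI finite_subset)
    show False
    proof (cases "\<exists>y\<in>?O. \<exists>z\<in>F - ?O. b y = b z")
      case True
      then obtain y z where yz: "y \<in> ?O" "z \<in> F" "z \<notin> ?O" "b y = b z" by blast
      have y: "y \<in> F" using yz OF by blast
      have "b ` ?O \<subseteq> b ` orbit_of (swap_values T y z) x"
        using orbit_of_swap_values[OF fin bij x yz(1-3)] by blast
      then have "card (b ` ?O) \<le> card (b ` orbit_of (swap_values T y z) x)"
        by (rule card_mono[OF finO'[OF y yz(2)]])
      then have "P (swap_values T y z)"
        using T bij_betw_swap_values[OF bij y yz(2)]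
          card_matched_swap_same_colour[of y F z b c T] y yz by (auto simp: P_def)
      then show False using contra yz by blast
    next
      case False
      have "insert (b z0) (b ` ?O) \<subseteq> b ` orbit_of (swap_values T x z0) x"
        using orbit_of_swap_values[OF fin bij x orbit_of_self z0] by blast
      then have "card (insert (b z0) (b ` ?O)) \<le> card (b ` orbit_of (swap_values T x z0) x)"
        by (rule card_mono[OF finO'[OF x z0(1)]])
      moreover have "b z0 \<notin> b ` ?O" using False z0 by (metis DiffI imageE)
      moreover have "finite (b ` ?O)" using OF fin finite_subset by blast
      ultimately have "card (b ` ?O) + 1 \<le> card (b ` orbit_of (swap_values T x z0) x)" by simp
      then have "P (swap_values T x z0)"
        using T bij_betw_swap_values[OF bij x z0(1)] card_matched_swap[OF fin, of b c T x z0]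
        by (auto simp: P_def)
      then show False using contra[OF orbit_of_self z0] by blast
    qed
  qed
  then show ?thesis using T by (auto simp: P_def)
qed

lemma cyclic_matching:
  fixes b c :: "'a \<Rightarrow> nat"
  assumes fin: "finite F" and x: "x \<in> F" and b: "\<And>y. y \<in> F \<Longrightarrow> b y \<le> m"
  shows "\<exists>T. bij_betw T F F \<and> orbit_of T x = F \<and>
    (\<Sum>k\<le>m. min (card {y \<in> F. b y = k}) (card {y \<in> F. c y = k}))
      \<le> card {y \<in> F. b y = c (T y)} + 2 * (m + 1)"
proof -
  obtain f where f: "bij_betw f F F"
    and min: "\<And>k. min (card {y \<in> F. b y = k}) (card {y \<in> F. c y = k})
      \<le> card {y \<in> F. b y = k \<and> c (f y) = k}"
    using exists_matching_permutation[OF fin, of b c] by (elim exE conjE) auto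
  obtain T where T: "bij_betw T F F" "orbit_of T x = F"
    "card (matched F b c f) \<le> card (matched F b c T) + 2 * card (b ` F)"
    using exists_cyclic_permutation[OF fin x f, of b c] by blast
  have "(\<Sum>k\<le>m. min (card {y \<in> F. b y = k}) (card {y \<in> F. c y = k}))
      \<le> (\<Sum>k\<le>m. card {y \<in> F. b y = k \<and> c (f y) = k})" by (intro sum_mono min)
  also have "\<dots> = card (\<Union>k\<le>m. {y \<in> F. b y = k \<and> c (f y) = k})"
    using fin by (subst card_UN_disjoint) auto
  also have "(\<Union>k\<le>m. {y \<in> F. b y = k \<and> c (f y) = k}) = matched F b c f"
    using b by (auto simp: matched_def) metis
  finally have "(\<Sum>k\<le>m. min (card {y \<in> F. b y = k}) (card {y \<in> F. c y = k}))
    \<le> card (matched F b c f)" .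
  moreover have "card (b ` F) \<le> card {..m}" using b by (intro card_mono) auto
  ultimately show ?thesis using T(3) by (intro exI[of _ T] conjI T) (simp add: matched_def)
qed

section \<open>Borel sets and finite-valued Borel maps on compact metric spaces\<close>

text \<open>
  An open set is the increasing union of the closed sets of points at distance at least
  \<open>1 / n\<close> from its complement.
\<close>

lemma open_inner_closed:
  fixes M :: "'a::metric_space measure"
  assumes "finite_measure M" and sets: "sets M = sets borel" and "open S" and "0 < e"
  shows "\<exists>C. closed C \<and> C \<subseteq> S \<and> measure M (S - C) < e"
proof (cases "S = UNIV")
  case True
  then show ?thesis using \<open>0 < e\<close> by (intro exI[of _ UNIV]) auto
next
  case False
  interpret finite_measure M by fact
  define C where "C n = {x. 1 / real (Suc n) \<le> infdist x (- S)}" for n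
  have closed: "closed (C n)" for n
    unfolding C_def by (intro closed_Collect_le continuous_intros)
  have sub: "C n \<subseteq> S" for n
  proof
    fix x assume "x \<in> C n"
    then have "1 / real (Suc n) \<le> infdist x (- S)" by (simp add: C_def)
    then have "0 < infdist x (- S)" by (rule less_le_trans[rotated]) simp
    then show "x \<in> S" using infdist_zero[of x "- S"] by (cases "x \<in> S") auto
  qed
  have "(\<Inter>n. S - C n) = {}"
  proof -
    have "\<exists>n. x \<in> C n" if "x \<in> S" for x
    proof -
      have "0 < infdist x (- S)"
        using that \<open>open S\<close> False infdist_pos_not_in_closed[of "- S" x] by auto
      then obtain n where "inverse (real (Suc n)) < infdist x (- S)" using reals_Archimedean by blast
      then show ?thesis by (auto simp: C_def inverse_eq_divide intro!: exI[of _ n])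
    qed
    then show ?thesis by auto
  qed
  moreover have "(\<lambda>n. measure M (S - C n)) \<longlonglongrightarrow> measure M (\<Inter>n. S - C n)"
  proof (rule finite_Lim_measure_decseq)
    show "range (\<lambda>n. S - C n) \<subseteq> sets M" using \<open>open S\<close> closed by (auto simp: sets)
    have "C m \<subseteq> C n" if "m \<le> n" for m n
    proof -
      have "1 / real (Suc n) \<le> 1 / real (Suc m)" using that by (intro divide_left_mono) auto
      then show ?thesis by (auto simp: C_def)
    qed
    then show "decseq (\<lambda>n. S - C n)" by (auto simp: decseq_def)
  qed
  ultimately have "(\<lambda>n. measure M (S - C n)) \<longlonglongrightarrow> 0" by (metis measure_empty)
  then obtain n where "measure M (S - C n) < e"
    using \<open>0 < e\<close> order_tendstoD(2)[of _ 0 sequentially e]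
    by (auto simp: eventually_sequentially)
  then show ?thesis using closed sub by blast
qed

text \<open>
  Regularity of finite Borel measures holds on every metric space: the sets that have the
  approximation property form a \<open>\<sigma>\<close>-algebra that contains the open sets.
\<close>

lemma borel_closed_open_sandwich:
  fixes M :: "'a::metric_space measure"
  assumes fin: "finite_measure M" and sets: "sets M = sets borel" and "A \<in> sets M" and "0 < e"
  shows "\<exists>C S. closed C \<and> open S \<and> C \<subseteq> A \<and> A \<subseteq> S \<and> measure M (S - C) < e"
proof -
  interpret finite_measure M by fact
  have "A \<in> sigma_sets UNIV {S. open S}" using \<open>A \<in> sets M\<close> unfolding sets by (simp add: borel_def)
  then show ?thesis using \<open>0 < e\<close>
  proof (induction arbitrary: e rule: sigma_sets.induct)
    case (Basic S)
    then show ?case using open_inner_closed[OF fin sets, of S e] by blast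
  next
    case Empty
    then show ?case by (intro exI[of _ "{}"]) auto
  next
    case (Compl A)
    obtain C S where "closed C" "open S" "C \<subseteq> A" "A \<subseteq> S" "measure M (S - C) < e"
      using Compl.IH[OF Compl.prems] by blast
    moreover have "- C - (- S) = S - C" by auto
    ultimately show ?case by (intro exI[of _ "- S"] exI[of _ "- C"]) auto
  next
    case (Union A)
    have ex: "\<forall>i. \<exists>C S. closed C \<and> open S \<and> C \<subseteq> A i \<and> A i \<subseteq> S \<and>
        measure M (S - C) < e / 2 * (1 / 2) ^ Suc i"
      using Union.prems by (intro allI Union.IH) simp
    then obtain C S where CS: "\<And>i. closed (C i)" "\<And>i. open (S i)" "\<And>i. C i \<subseteq> A i" "\<And>i. A i \<subseteq> S i"
        "\<And>i. measure M (S i - C i) < e / 2 * (1 / 2) ^ Suc i" by metis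
    have meas: "S i - C i \<in> sets M" "C i \<in> sets M" "S i \<in> sets M" for i using CS(1,2) by (auto simp: sets)
    let ?S = "\<Union>i. S i"
    have sums: "(\<lambda>i. e / 2 * (1 / 2) ^ Suc i) sums (e / 2)"
      using sums_mult[OF power_half_series, of "e / 2"] by simp
    have summ: "summable (\<lambda>i. measure M (S i - C i))"
      using CS(5) by (intro summable_comparison_test'[OF sums_summable[OF sums], of 0]) (simp add: less_imp_le)
    have "measure M (\<Union>i. S i - C i) \<le> (\<Sum>i. measure M (S i - C i))"
      using meas summ by (intro finite_measure_subadditive_countably) auto
    also have "\<dots> \<le> e / 2"
      using CS(5) summ sums by (intro order_trans[OF suminf_le[OF _ summ sums_summable[OF sums]]])
        (auto simp: less_imp_le sums_unique[symmetric])
    finally have half: "measure M (\<Union>i. S i - C i) \<le> e / 2" .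
    have "measure M (\<Inter>n. ?S - (\<Union>i\<le>n. C i)) \<le> measure M (\<Union>i. S i - C i)"
    proof (rule finite_measure_mono)
      show "(\<Inter>n. ?S - (\<Union>i\<le>n. C i)) \<subseteq> (\<Union>i. S i - C i)" by (auto simp: Ball_def)
    qed (use meas in auto)
    then have lim: "measure M (\<Inter>n. ?S - (\<Union>i\<le>n. C i)) < e" using half Union.prems by linarith
    have "(\<lambda>n. measure M (?S - (\<Union>i\<le>n. C i))) \<longlonglongrightarrow> measure M (\<Inter>n. ?S - (\<Union>i\<le>n. C i))"
    proof (rule finite_Lim_measure_decseq)
      show "range (\<lambda>n. ?S - (\<Union>i\<le>n. C i)) \<subseteq> sets M" using meas by auto
      show "decseq (\<lambda>n. ?S - (\<Union>i\<le>n. C i))" unfolding decseq_def by fastforce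
    qed
    from order_tendstoD(2)[OF this lim]
    obtain n where n: "measure M (?S - (\<Union>i\<le>n. C i)) < e" by (auto simp: eventually_sequentially)
    show ?case
    proof (intro exI conjI)
      show "closed (\<Union>i\<le>n. C i)" using CS(1) by auto
      show "open ?S" using CS(2) by auto
      show "(\<Union>i\<le>n. C i) \<subseteq> (\<Union>i. A i)" "(\<Union>i. A i) \<subseteq> ?S" using CS(3,4) by blast+
    qed (rule n)
  qed
qed

text \<open>
  Lusin's theorem for maps with finitely many values: the fibres contain closed sets of almost the
  same measure, and finitely many disjoint compact sets have a positive distance from each other.
\<close>

lemma lusin_finite_valued:
  fixes M :: "'a::metric_space measure" and g :: "'a \<Rightarrow> nat"
  assumes comp: "compact (UNIV :: 'a set)" and fin: "finite_measure M" and sets: "sets M = sets borel"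
    and g: "\<And>k. {x. g x = k} \<in> sets M" and m: "\<And>x. g x < m" and "0 < e"
  shows "\<exists>J \<rho>. closed J \<and> 0 < \<rho> \<and> measure M (- J) < e \<and>
    (\<forall>x\<in>J. \<forall>x'\<in>J. dist x x' < \<rho> \<longrightarrow> g x = g x')"
proof -
  interpret finite_measure M by fact
  have "0 < m" using m[of undefined] by simp
  then have "\<forall>k. \<exists>C. closed C \<and> C \<subseteq> {x. g x = k} \<and> measure M ({x. g x = k} - C) < e / m"
  proof (intro allI)
    fix k
    obtain C S where CS: "closed C" "open S" "C \<subseteq> {x. g x = k}" "{x. g x = k} \<subseteq> S" "measure M (S - C) < e / m"
      using borel_closed_open_sandwich[OF fin sets g[of k], of "e / m"] \<open>0 < e\<close> \<open>0 < m\<close> by auto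
    have "measure M ({x. g x = k} - C) \<le> measure M (S - C)"
      using CS by (intro finite_measure_mono) (auto simp: sets)
    then show "\<exists>C. closed C \<and> C \<subseteq> {x. g x = k} \<and> measure M ({x. g x = k} - C) < e / m"
      using CS by (intro exI[of _ C]) auto
  qed
  then obtain C where C: "\<And>k. closed (C k)" "\<And>k. C k \<subseteq> {x. g x = k}"
    "\<And>k. measure M ({x. g x = k} - C k) < e / m" by metis
  have gC: "x \<in> C k \<Longrightarrow> g x = k" for x k using C(2) by blast
  let ?J = "\<Union>k<m. C k"
  have clJ: "closed ?J" using C(1) by auto
  have meas: "{x. g x = k} - C k \<in> sets M" for k using g C(1) by (auto simp: sets)
  have "measure M (- ?J) \<le> measure M (\<Union>k<m. {x. g x = k} - C k)"
    using meas m clJ by (intro finite_measure_mono) (auto simp: sets)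
  also have "\<dots> \<le> (\<Sum>k<m. measure M ({x. g x = k} - C k))"
    using meas by (intro finite_measure_subadditive_finite) auto
  also have "\<dots> < (\<Sum>k<m. e / m)" using C(3) \<open>0 < m\<close> by (intro sum_strict_mono) auto
  also have "\<dots> = e" using \<open>0 < m\<close> by simp
  finally have small: "measure M (- ?J) < e" .
  define O' where "O' k = - (\<Union>j\<in>{..<m} - {k}. C j)" for k
  (* O' k is an open set that meets J exactly in C k; a Lebesgue number of this cover separates the fibres. *)
  have compJ: "compact ?J" using compact_Int_closed[OF comp clJ] by simp
  have cover: "?J \<subseteq> \<Union> (O' ` {..<m})"
    using gC unfolding O'_def by blast
  obtain \<rho> where \<rho>: "0 < \<rho>" "\<And>x. x \<in> ?J \<Longrightarrow> \<exists>G\<in>O' ` {..<m}. ball x \<rho> \<subseteq> G"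
  proof (rule Heine_Borel_lemma[OF compJ cover])
    fix G assume "G \<in> O' ` {..<m}"
    then show "open G" using C(1) unfolding O'_def by (auto intro!: open_Compl closed_UN)
  qed blast
  have "g x = g x'" if xx': "x \<in> ?J" "x' \<in> ?J" "dist x x' < \<rho>" for x x'
  proof -
    obtain k where k: "ball x \<rho> \<subseteq> O' k" using \<rho>(2)[OF xx'(1)] by blast
    have "g z = k" if "z \<in> ?J" "z \<in> ball x \<rho>" for z
      using that k gC unfolding O'_def by blast
    then show ?thesis using xx' \<rho>(1) by simp
  qed
  then show ?thesis using clJ small \<rho>(1) by blast
qed

lemma small_borel_partition:
  assumes comp: "compact (UNIV :: 'a::metric_space set)" and "0 < r"
  shows "\<exists>m (g :: 'a \<Rightarrow> nat). (\<forall>x. g x < m) \<and> (\<forall>x x'. g x = g x' \<longrightarrow> dist x x' < r) \<and>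
    (\<forall>k. {x. g x = k} \<in> sets borel)"
proof -
  obtain K :: "'a set" where K: "finite K" "UNIV \<subseteq> (\<Union>x\<in>K. ball x (r / 2))"
    using comp \<open>0 < r\<close> unfolding compact_eq_totally_bounded by (metis half_gt_zero)
  obtain xs where xs: "set xs = K" using finite_list[OF K(1)] by blast
  define g where "g x = (LEAST i. i < length xs \<and> x \<in> ball (xs ! i) (r / 2))" for x
  have g: "g x < length xs \<and> x \<in> ball (xs ! g x) (r / 2)" for x
  proof -
    have "\<exists>i. i < length xs \<and> x \<in> ball (xs ! i) (r / 2)"
      using K(2) unfolding xs[symmetric] by (force simp: in_set_conv_nth)
    then show ?thesis unfolding g_def by (rule LeastI_ex)
  qed
  have "dist x x' < r" if "g x = g x'" for x x'
  proof -
    have "dist (xs ! g x) x < r / 2" "dist (xs ! g x) x' < r / 2" using g[of x] g[of x'] that by auto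
    then show ?thesis using dist_triangle_half_r by blast
  qed
  moreover have "{x. g x = k} \<in> sets borel" for k
  proof -
    have "{x. g x = k} = (if k < length xs
        then ball (xs ! k) (r / 2) - (\<Union>i<k. ball (xs ! i) (r / 2)) else {})"
    proof (cases "k < length xs")
      case True
      have "g x = k \<longleftrightarrow> x \<in> ball (xs ! k) (r / 2) \<and> (\<forall>i<k. x \<notin> ball (xs ! i) (r / 2))" for x
      proof
        assume "g x = k"
        then show "x \<in> ball (xs ! k) (r / 2) \<and> (\<forall>i<k. x \<notin> ball (xs ! i) (r / 2))"
          using g[of x] True not_less_Least[of _ "\<lambda>i. i < length xs \<and> x \<in> ball (xs ! i) (r / 2)"]
          unfolding g_def[symmetric] by (metis order.strict_trans)
      next
        assume "x \<in> ball (xs ! k) (r / 2) \<and> (\<forall>i<k. x \<notin> ball (xs ! i) (r / 2))"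
        then show "g x = k" unfolding g_def using True
          by (intro Least_equality) (auto simp: not_less[symmetric])
      qed
      then show ?thesis using True by auto
    next
      case False
      then show ?thesis using g by (metis (mono_tags, lifting) Collect_empty_eq)
    qed
    then show ?thesis by auto
  qed
  ultimately show ?thesis using g by blast
qed

section \<open>Finite sets whose uniform distribution is close to a measure\<close>

text \<open>
  Convergence of the uniform distributions of finite sets to \<open>M\<close> in the weak topology,
  in the form given by the portmanteau theorem: an open set eventually gets
  at least its measure, up to any error.
\<close>

definition uniform_near :: "'a::metric_space measure \<Rightarrow> 'a set filter" where
  "uniform_near M = (INF (S, r :: real)\<in>{(S, r). open S \<and> r < measure M S}.
     principal {F. finite F \<and> F \<noteq> {} \<and> r * real (card F) < real (card (F \<inter> S))})"

lemma eventually_uniform_near: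
  fixes r :: real
  assumes "open S" "r < measure M S"
  shows "eventually (\<lambda>F. finite F \<and> F \<noteq> {} \<and> r * card F < card (F \<inter> S)) (uniform_near M)"
  unfolding uniform_near_def
  by (rule eventually_INF1[of "(S, r)"]) (use assms in \<open>auto simp: eventually_principal\<close>)

lemma nonatomic_singleton:
  fixes M :: "'a::metric_space measure"
  assumes "nonatomic M" and sets: "sets M = sets borel"
  shows "emeasure M {x} = 0"
proof (rule ccontr)
  assume "emeasure M {x} \<noteq> 0"
  moreover have "{x} \<in> sets M" by (simp add: sets)
  ultimately obtain B where "B \<subseteq> {x}" "0 < emeasure M B" "emeasure M B < emeasure M {x}"
    using assms(1) unfolding nonatomic_def by (meson zero_less_iff_neq_zero)
  then show False by (cases "B = {}") (auto simp: subset_singleton_iff)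
qed

text \<open>
  The closed balls around \<open>x\<close> shrink to the null set \<open>{x}\<close>.
\<close>

lemma small_closed_ball:
  fixes M :: "'a::metric_space measure"
  assumes "finite_measure M" and na: "nonatomic M" and sets: "sets M = sets borel" and "0 < e"
  shows "\<exists>r>0. measure M (cball x r) < e"
proof -
  interpret finite_measure M by fact
  have "(\<Inter>n. cball x (1 / real (Suc n))) = {x}"
  proof
    show "(\<Inter>n. cball x (1 / real (Suc n))) \<subseteq> {x}"
    proof
      fix y assume y: "y \<in> (\<Inter>n. cball x (1 / real (Suc n)))"
      then have "dist x y \<le> inverse (real (Suc n))" for n by (auto simp: inverse_eq_divide)
      then have "\<not> 0 < dist x y" using reals_Archimedean[of "dist x y"] by (metis not_le)
      then show "y \<in> {x}" by simp
    qed
  qed auto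
  then have "measure M (\<Inter>n. cball x (1 / real (Suc n))) = 0"
    using nonatomic_singleton[OF na sets] by (simp add: measure_def)
  moreover have "(\<lambda>n. measure M (cball x (1 / real (Suc n))))
      \<longlonglongrightarrow> measure M (\<Inter>n. cball x (1 / real (Suc n)))"
  proof (rule finite_Lim_measure_decseq)
    have "cball x (1 / real (Suc n)) \<subseteq> cball x (1 / real (Suc m))" if "m \<le> n" for m n
      using that by (intro subset_cball divide_left_mono) auto
    then show "decseq (\<lambda>n. cball x (1 / real (Suc n)))" by (auto simp: decseq_def)
  qed (auto simp: sets)
  ultimately have "(\<lambda>n. measure M (cball x (1 / real (Suc n)))) \<longlonglongrightarrow> 0" by metis
  from order_tendstoD(2)[OF this \<open>0 < e\<close>]
  obtain n where "measure M (cball x (1 / real (Suc n))) < e" by (auto simp: eventually_sequentially)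
  then show ?thesis by (intro exI[of _ "1 / real (Suc n)"]) auto
qed

lemma card_complement_real:
  assumes "finite F"
  shows "real (card (F - S)) = card F - real (card (F \<inter> S))"
  using assms card_Diff_subset_Int[of F S] card_mono[of F "F \<inter> S"] by (simp add: of_nat_diff)

text \<open>
  Cover the space by finitely many balls of measure less than \<open>1 / (R + 1)\<close>. A nonempty set with at most \<open>R\<close>
  points has a share of at least \<open>1 / (R + 1)\<close> in one of them, whereas the complement of that ball must get
  almost its full measure.
\<close>

lemma eventually_card_gt:
  fixes M :: "'a::metric_space measure"
  assumes comp: "compact (UNIV :: 'a set)" and "prob_space M" and na: "nonatomic M"
    and sets: "sets M = sets borel"
  shows "eventually (\<lambda>F. R < card F) (uniform_near M)"
proof -
  interpret prob_space M by fact
  define e where "e = 1 / (real R + 1)"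
  have e: "0 < e" by (simp add: e_def)
  have sp: "space M = UNIV" using sets_eq_imp_space_eq[OF sets] by simp
  obtain r where r: "\<And>x. 0 < r x" "\<And>x. measure M (cball x (r x)) < e"
    using small_closed_ball[OF finite_measure_axioms na sets e] by metis
  have cover: "UNIV \<subseteq> (\<Union>x. ball x (r x))" 
  proof
    fix x show "x \<in> (\<Union>x. ball x (r x))" using r(1)[of x] by (intro UN_I[of x]) auto
  qed
  obtain K where K: "finite K" "UNIV \<subseteq> (\<Union>x\<in>K. ball x (r x))"
    using compactE_image[OF comp open_ball cover] by metis
  have "eventually (\<lambda>F. finite F \<and> F \<noteq> {} \<and> (1 - e) * card F < card (F \<inter> - cball x (r x)))
      (uniform_near M)" for x
  proof (rule eventually_uniform_near)
    show "1 - e < prob (- cball x (r x))"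
      using prob_compl[of "cball x (r x)"] r(2)[of x] by (simp add: sp Compl_eq_Diff_UNIV sets)
  qed auto
  then have "eventually (\<lambda>F. \<forall>x\<in>K. finite F \<and> F \<noteq> {} \<and> (1 - e) * card F < card (F \<inter> - cball x (r x)))
      (uniform_near M)"
    using K(1) by (intro eventually_ball_finite) auto
  then show ?thesis
  proof eventually_elim
    case F: (elim F)
    show ?case
    proof (rule ccontr)
      assume "\<not> R < card F"
      then have "e * card F < 1" by (simp add: e_def field_simps)
      have "F \<inter> cball x (r x) = {}" if "x \<in> K" for x
      proof -
        have finF: "finite F" using F that by blast
        have "(1 - e) * card F < card (F - cball x (r x))" using F that by (simp add: Diff_eq)
        then have "real (card (F \<inter> cball x (r x))) < 1"
          using card_complement_real[OF finF, of "cball x (r x)"] \<open>e * card F < 1\<close>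
          by (simp add: algebra_simps)
        then show ?thesis using finF by simp
      qed
      moreover have "K \<noteq> {}" using K(2) by auto
      then obtain y where "y \<in> F" using F by blast
      moreover obtain x where "x \<in> K" "y \<in> ball x (r x)" using K(2) by blast
      ultimately show False by (fastforce simp: disjoint_iff)
    qed
  qed
qed

text \<open>
  The pairs in an open neighbourhood of the graph of \<open>\<tau>\<close> restricted to \<open>L\<close>, with tolerance \<open>d\<close> for arguments and
  \<open>e\<close> for values. Working with such neighbourhoods instead of \<open>\<tau>\<close> itself is what makes sense of
  the closeness of \<open>T y\<close> to \<open>\<tau> y\<close> for points \<open>y\<close> at which \<open>\<tau>\<close> is not continuous.
\<close>

definition near_graph :: "('a::metric_space \<Rightarrow> 'a) \<Rightarrow> 'a set \<Rightarrow> real \<Rightarrow> real \<Rightarrow> 'a \<Rightarrow> 'a \<Rightarrow> bool" where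
  "near_graph \<tau> L d e y z \<longleftrightarrow> (\<exists>x\<in>L. dist y x < d \<and> dist z (\<tau> x) < e)"

text \<open>
  If \<open>g\<close> is constant on pieces of \<open>J\<close> that are \<open>2 * \<rho>\<close> apart, its values extend to the
  \<open>\<rho>\<close>-neighbourhood of \<open>J\<close>; the extra colour \<open>m\<close> marks the remaining points.
\<close>

lemma ex_neighbourhood_colour:
  fixes g :: "'a::metric_space \<Rightarrow> nat"
  assumes sep: "\<And>x x'. x \<in> J \<Longrightarrow> x' \<in> J \<Longrightarrow> dist x x' < 2 * \<rho> \<Longrightarrow> g x = g x'" and m: "\<And>x. g x < m"
  shows "\<exists>b. (\<forall>y. b y \<le> m) \<and> (\<forall>y. b y < m \<longrightarrow> (\<exists>x\<in>J. dist x y < \<rho>)) \<and>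
    (\<forall>x\<in>J. \<forall>y. dist x y < \<rho> \<longrightarrow> b y = g x)"
proof -
  have "\<exists>k\<le>m. (k < m \<longrightarrow> (\<exists>x\<in>J. dist x y < \<rho>)) \<and> (\<forall>x\<in>J. dist x y < \<rho> \<longrightarrow> k = g x)" for y
  proof (cases "\<exists>x\<in>J. dist x y < \<rho>")
    case True
    then obtain x where x: "x \<in> J" "dist x y < \<rho>" by blast
    show ?thesis
    proof (intro exI[of _ "g x"] conjI ballI impI)
      fix x' assume "x' \<in> J" "dist x' y < \<rho>"
      then show "g x = g x'" using x dist_triangle2[of x x' y] by (intro sep) auto
    qed (use x m[of x] in auto)
  next
    case False
    then show ?thesis by (intro exI[of _ m]) auto
  qed
  then show ?thesis by metis
qed

text \<open>
  The standard core of the lifting theorem. The sets \<open>L n\<close> are arbitrary closed sets of large measure: continuity of \<open>\<tau>\<close>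
  on them matters only when the conclusion is interpreted. For a point \<open>y\<close> near
  \<open>x \<in> J \<inter> L n\<close> whose colour is matched, \<open>T y\<close> is near a point in the same small
  piece as \<open>\<tau> x\<close>, and so the pair \<open>(y, T y)\<close> is in the neighbourhood of the graph over \<open>L n\<close>.
\<close>

theorem eventually_cyclic_permutation:
  fixes M :: "'a::metric_space measure" and \<beta> :: "nat \<Rightarrow> real"
  assumes comp: "compact (UNIV :: 'a set)" and "prob_space M" and sets: "sets M = sets borel"
    and na: "nonatomic M" and \<tau>: "measure_preserving M M \<tau>"
    and L: "\<And>n. closed (L n)" and d: "\<And>n::nat. 0 < d n" and e: "\<And>n. 0 < e n"
    and \<beta>: "\<And>n. measure M (- L n) < \<beta> n"
  shows "eventually (\<lambda>F. \<exists>T x. x \<in> F \<and> bij_betw T F F \<and> orbit_of T x = F \<and>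
      (\<forall>n\<le>N. card {y \<in> F. \<not> near_graph \<tau> (L n) (d n) (e n) y (T y)} \<le> \<beta> n * card F))
    (uniform_near M)"
proof -
  interpret prob_space M by fact
  have sp: "space M = UNIV" using sets_eq_imp_space_eq[OF sets] by simp
  (* The slack that is left in the conditions n \<le> N; it is shared out among m + 2 errors of size \<eta>:
     one for J, one for the size of F, and one for each of the m colours. *)
  define \<gamma> where "\<gamma> = Min ((\<lambda>n. \<beta> n - prob (- L n)) ` {..N})"
  have \<gamma>0: "0 < \<gamma>" using \<beta> by (auto simp: \<gamma>_def)
  have \<gamma>: "\<gamma> \<le> \<beta> n - prob (- L n)" if "n \<le> N" for n using that by (auto simp: \<gamma>_def)
  (* Pieces of diameter below r and neighbourhoods of radius at most r respect the tolerances n \<le> N. *)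
  define r where "r = Min ((\<lambda>n. min (d n) (e n / 2)) ` {..N})"
  have r0: "0 < r" using d e by (auto simp: r_def)
  have r: "r \<le> min (d n) (e n / 2)" if "n \<le> N" for n unfolding r_def using that by (intro Min_le) auto
  obtain m and g :: "'a \<Rightarrow> nat" where m: "\<And>x. g x < m"
    and diam: "\<And>x x'. g x = g x' \<Longrightarrow> dist x x' < r" and "\<And>k. {x. g x = k} \<in> sets borel"
    using small_borel_partition[OF comp r0] by blast
  then have g: "{x. g x = k} \<in> sets M" for k by (simp add: sets)
  have \<tau>m: "\<tau> \<in> measurable M M" using \<tau> by (simp add: measure_preserving_def)
  have \<tau>g: "{x. g (\<tau> x) = k} \<in> sets M" for k
    using measurable_sets[OF \<tau>m g[of k]] by (simp add: sp vimage_def)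
  have p\<tau>: "prob {x. g (\<tau> x) = k} = prob {x. g x = k}" for k
    using \<tau> measure_distr[OF \<tau>m g[of k]] by (simp add: measure_preserving_def sp vimage_def)
  have sum_p: "(\<Sum>k<m. prob {x. g x = k}) = 1"
  proof -
    have "(\<Sum>k<m. prob {x. g x = k}) = prob (\<Union>k<m. {x. g x = k})"
      using g by (intro finite_measure_finite_Union[symmetric]) (auto simp: disjoint_family_on_def)
    also have "(\<Union>k<m. {x. g x = k}) = space M" using m by (auto simp: sp)
    finally show ?thesis by (simp add: prob_space)
  qed
  define \<eta> where "\<eta> = \<gamma> / (real m + 2)"
  have \<eta>: "0 < \<eta>" "(real m + 2) * \<eta> = \<gamma>" using \<gamma>0 by (auto simp: \<eta>_def)
  obtain J \<rho>1 where J: "closed J" "0 < \<rho>1" "prob (- J) < \<eta>"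
    "\<And>x x'. x \<in> J \<Longrightarrow> x' \<in> J \<Longrightarrow> dist x x' < \<rho>1 \<Longrightarrow> g (\<tau> x) = g (\<tau> x')"
    using lusin_finite_valued[OF comp finite_measure_axioms sets \<tau>g m \<eta>(1)] by blast
  obtain J' \<rho>2 where J': "closed J'" "0 < \<rho>2" "prob (- J') < \<eta>"
    "\<And>x x'. x \<in> J' \<Longrightarrow> x' \<in> J' \<Longrightarrow> dist x x' < \<rho>2 \<Longrightarrow> g x = g x'"
    using lusin_finite_valued[OF comp finite_measure_axioms sets g m \<eta>(1)] by blast
  define \<rho> where "\<rho> = min r (min \<rho>1 \<rho>2 / 2)"
  have \<rho>: "0 < \<rho>" "\<rho> \<le> r" "2 * \<rho> \<le> \<rho>1" "2 * \<rho> \<le> \<rho>2" using r0 J(2) J'(2) by (auto simp: \<rho>_def)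
  obtain b where b: "\<And>y. b y \<le> m" "\<And>y. b y < m \<Longrightarrow> \<exists>x\<in>J. dist x y < \<rho>"
    "\<And>x y. x \<in> J \<Longrightarrow> dist x y < \<rho> \<Longrightarrow> b y = g (\<tau> x)"
    using ex_neighbourhood_colour[of J \<rho> "\<lambda>x. g (\<tau> x)" m, OF J(4)[OF _ _ less_le_trans[OF _ \<rho>(3)]] m]
    by blast
  obtain c where c: "\<And>y. c y \<le> m" "\<And>y. c y < m \<Longrightarrow> \<exists>x\<in>J'. dist x y < \<rho>"
    "\<And>x y. x \<in> J' \<Longrightarrow> dist x y < \<rho> \<Longrightarrow> c y = g x"
    using ex_neighbourhood_colour[of J' \<rho> g m, OF J'(4)[OF _ _ less_le_trans[OF _ \<rho>(4)]] m]
    by blast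
  define nbhd where "nbhd S = (\<Union>x\<in>S. ball x \<rho>)" for S :: "'a set"
  have open_nbhd: "open (nbhd S)" for S by (auto simp: nbhd_def)
  have large: "eventually (\<lambda>F. finite F \<and> F \<noteq> {} \<and> (q - \<eta>) * card F < card (F \<inter> nbhd (K \<inter> A)))
      (uniform_near M)"
    if "K \<in> sets M" "prob (- K) < \<eta>" "A \<in> sets M" "q = prob A" for K A q
  proof (rule eventually_uniform_near[OF open_nbhd])
    have nb: "nbhd (K \<inter> A) \<in> sets M" using open_nbhd by (simp add: sets)
    have "prob A \<le> prob (nbhd (K \<inter> A) \<union> - K)"
    proof (rule finite_measure_mono)
      show "A \<subseteq> nbhd (K \<inter> A) \<union> - K" using \<rho>(1) by (auto simp: nbhd_def)
      show "nbhd (K \<inter> A) \<union> - K \<in> sets M"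
        using nb sets.compl_sets[OF that(1)] by (simp add: sp Compl_eq_Diff_UNIV)
    qed
    also have "\<dots> \<le> prob (nbhd (K \<inter> A)) + prob (- K)"
      using nb sets.compl_sets[OF that(1)]
      by (intro measure_Un_le) (auto simp: sp Compl_eq_Diff_UNIV)
    finally show "q - \<eta> < prob (nbhd (K \<inter> A))" using that by linarith
  qed
  have Js: "J \<in> sets M" "J' \<in> sets M" "L n \<in> sets M" for n using J(1) J'(1) L by (auto simp: sets)
  obtain R where R: "2 * (real m + 1) / \<eta> < real R" using reals_Archimedean2 by blast
  have prob_L: "1 - prob (- L n) = prob (L n)" for n
    using prob_compl[OF Js(3)[of n]] by (simp add: sp Compl_eq_Diff_UNIV)
  have "eventually (\<lambda>F. R < card F) (uniform_near M)"
    by (rule eventually_card_gt[OF comp \<open>prob_space M\<close> na sets])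
  moreover have "eventually (\<lambda>F. \<forall>k\<in>{..<m}. finite F \<and> F \<noteq> {} \<and>
      (prob {x. g x = k} - \<eta>) * card F < card (F \<inter> nbhd (J \<inter> {x. g (\<tau> x) = k}))) (uniform_near M)"
    using large[OF Js(1) J(3) \<tau>g p\<tau>[symmetric]] by (intro eventually_ball_finite) auto
  moreover have "eventually (\<lambda>F. \<forall>k\<in>{..<m}. finite F \<and> F \<noteq> {} \<and>
      (prob {x. g x = k} - \<eta>) * card F < card (F \<inter> nbhd (J' \<inter> {x. g x = k}))) (uniform_near M)"
    using large[OF Js(2) J'(3) g refl] by (intro eventually_ball_finite) auto
  moreover have "eventually (\<lambda>F. \<forall>n\<in>{..N}. finite F \<and> F \<noteq> {} \<and>
      (1 - prob (- L n) - \<eta>) * card F < card (F \<inter> nbhd (J \<inter> L n))) (uniform_near M)"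
    using large[OF Js(1) J(3) Js(3) prob_L] by (intro eventually_ball_finite) auto
  ultimately show ?thesis
  proof eventually_elim
    case (elim F)
    have fin: "finite F" and "F \<noteq> {}" using elim(4) by auto
    then obtain x where x: "x \<in> F" by blast
    obtain T where T: "bij_betw T F F" "orbit_of T x = F"
      "(\<Sum>k\<le>m. min (card {y \<in> F. b y = k}) (card {y \<in> F. c y = k}))
        \<le> card {y \<in> F. b y = c (T y)} + 2 * (m + 1)"
      using cyclic_matching[where F = F and b = b and c = c and m = m, OF fin x b(1)] by (elim exE conjE) (rule that)
    have colour: "(prob {x. g x = k} - \<eta>) * card F \<le> min (card {y \<in> F. b y = k}) (card {y \<in> F. c y = k})"
      if "k < m" for k
    proof -
      have "card (F \<inter> nbhd (J \<inter> {x. g (\<tau> x) = k})) \<le> card {y \<in> F. b y = k}"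
        using fin b(3) by (intro card_mono) (auto simp: nbhd_def)
      moreover have "card (F \<inter> nbhd (J' \<inter> {x. g x = k})) \<le> card {y \<in> F. c y = k}"
        using fin c(3) by (intro card_mono) (auto simp: nbhd_def)
      moreover have "(prob {x. g x = k} - \<eta>) * card F < card (F \<inter> nbhd (J \<inter> {x. g (\<tau> x) = k}))"
        "(prob {x. g x = k} - \<eta>) * card F < card (F \<inter> nbhd (J' \<inter> {x. g x = k}))"
        using elim(2,3) that by blast+
      ultimately show ?thesis by linarith
    qed
    (* The extra colour m is ignored: it only adds a nonnegative term to the sum over k \<le> m. *)
    have "(1 - m * \<eta>) * card F = (\<Sum>k<m. (prob {x. g x = k} - \<eta>) * card F)"
      using sum_p by (simp add: sum_distrib_right[symmetric] sum_subtractf)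
    also have "\<dots> \<le> (\<Sum>k<m. real (min (card {y \<in> F. b y = k}) (card {y \<in> F. c y = k})))"
      by (intro sum_mono) (use colour in auto)
    also have "\<dots> \<le> (\<Sum>k\<le>m. real (min (card {y \<in> F. b y = k}) (card {y \<in> F. c y = k})))"
      by (intro sum_mono2) auto
    also have "\<dots> \<le> card {y \<in> F. b y = c (T y)} + 2 * (real m + 1)"
      using of_nat_mono[OF T(3), where 'a = real] by simp
    finally have matched: "(1 - m * \<eta>) * card F - 2 * (real m + 1) \<le> card {y \<in> F. b y = c (T y)}" by simp
    have "2 * (real m + 1) \<le> \<eta> * R" using R \<eta>(1) by (simp add: field_simps)
    also have "\<dots> \<le> \<eta> * card F" using elim(1) \<eta>(1) by simp
    finally have small: "2 * (real m + 1) \<le> \<eta> * card F" .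
    have "card {y \<in> F. \<not> near_graph \<tau> (L n) (d n) (e n) y (T y)} \<le> \<beta> n * card F" if n: "n \<le> N" for n
    proof -
      (* A point near J has a colour below m, so its image is near J' and both lie over the same piece. *)
      have good: "near_graph \<tau> (L n) (d n) (e n) y (T y)"
        if y: "y \<in> nbhd (J \<inter> L n)" "b y = c (T y)" for y
      proof -
        obtain x where x: "x \<in> J" "x \<in> L n" "dist x y < \<rho>" using y(1) by (auto simp: nbhd_def)
        have "b y = g (\<tau> x)" using b(3) x by blast
        then have "c (T y) < m" using y(2) m by metis
        then obtain x' where x': "x' \<in> J'" "dist x' (T y) < \<rho>" using c(2) by blast
        then have "g x' = g (\<tau> x)" using c(3) y(2) \<open>b y = g (\<tau> x)\<close> by metis
        then have "dist x' (\<tau> x) < r" by (rule diam)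
        then have "dist (T y) (\<tau> x) < \<rho> + r"
          using x'(2) dist_triangle3[of "T y" "\<tau> x" x'] by linarith
        then have "dist y x < d n" "dist (T y) (\<tau> x) < e n"
          using x(3) \<rho>(2) r[OF n] by (auto simp: dist_commute)
        then show ?thesis using x(2) by (auto simp: near_graph_def)
      qed
      have "card {y \<in> F. \<not> near_graph \<tau> (L n) (d n) (e n) y (T y)}
          \<le> card ((F - nbhd (J \<inter> L n)) \<union> (F - {y \<in> F. b y = c (T y)}))"
        using fin good by (intro card_mono) auto
      also have "\<dots> \<le> card (F - nbhd (J \<inter> L n)) + card (F - {y \<in> F. b y = c (T y)})"
        by (rule card_Un_le)
      finally have "real (card {y \<in> F. \<not> near_graph \<tau> (L n) (d n) (e n) y (T y)})
          \<le> real (card (F - nbhd (J \<inter> L n))) + real (card (F - {y \<in> F. b y = c (T y)}))" by linarith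
      also have "\<dots> \<le> (prob (- L n) + \<eta>) * card F + m * \<eta> * card F + 2 * (real m + 1)"
      proof -
        have "(1 - prob (- L n) - \<eta>) * card F < card (F \<inter> nbhd (J \<inter> L n))"
          using elim(4) n by blast
        then have "real (card (F - nbhd (J \<inter> L n))) \<le> (prob (- L n) + \<eta>) * card F"
          using card_complement_real[OF fin, of "nbhd (J \<inter> L n)"] by (simp add: algebra_simps)
        moreover have "F \<inter> {y \<in> F. b y = c (T y)} = {y \<in> F. b y = c (T y)}" by auto
        then have "real (card (F - {y \<in> F. b y = c (T y)})) \<le> m * \<eta> * card F + 2 * (real m + 1)"
          using matched card_complement_real[OF fin, of "{y \<in> F. b y = c (T y)}"]
          by (simp add: algebra_simps)
        ultimately show ?thesis by linarith
      qed
      also have "\<dots> \<le> (prob (- L n) + \<eta>) * card F + m * \<eta> * card F + \<eta> * card F"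
        using small by simp
      also have "\<dots> = (prob (- L n) + (m + 2) * \<eta>) * card F" by (simp add: algebra_simps)
      also have "\<dots> \<le> \<beta> n * card F"
        using \<gamma>[OF n] \<eta>(2) by (intro mult_right_mono) (auto simp: add.commute)
      finally show ?thesis .
    qed
    then show ?case using x T by blast
  qed
qed

text \<open>
  Sets of almost full measure on which \<open>\<tau>\<close> is uniformly continuous at the scale \<open>e n\<close>: a map
  that picks a small Borel piece for \<open>\<tau> x\<close> has finitely many values.
\<close>

lemma lusin_sequence:
  fixes M :: "'a::metric_space measure"
  assumes comp: "compact (UNIV :: 'a set)" and fin: "finite_measure M" and sets: "sets M = sets borel"
    and \<tau>: "\<tau> \<in> measurable M M" and \<beta>: "\<And>n. 0 < \<beta> n" and e: "\<And>n. 0 < e n"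
  shows "\<exists>L d. \<forall>n::nat. closed (L n) \<and> 0 < d n \<and> measure M (- L n) < \<beta> n \<and>
    (\<forall>x\<in>L n. \<forall>x'\<in>L n. dist x x' < 2 * d n \<longrightarrow> dist (\<tau> x) (\<tau> x') < (e n :: real))"
proof -
  have sp: "space M = UNIV" using sets_eq_imp_space_eq[OF sets] by simp
  have "\<exists>L d. closed L \<and> 0 < d \<and> measure M (- L) < \<beta> n \<and>
    (\<forall>x\<in>L. \<forall>x'\<in>L. dist x x' < 2 * d \<longrightarrow> dist (\<tau> x) (\<tau> x') < e n)" for n
  proof -
    obtain m and g :: "'a \<Rightarrow> nat" where g: "\<And>x. g x < m" "\<And>x x'. g x = g x' \<Longrightarrow> dist x x' < e n"
      "\<And>k. {x. g x = k} \<in> sets borel"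
      using small_borel_partition[OF comp e] by metis
    have "{x. g (\<tau> x) = k} \<in> sets M" for k
      using measurable_sets[OF \<tau>, of "{x. g x = k}"] g(3) by (simp add: sp vimage_def sets)
    then obtain J \<rho> where J: "closed J" "0 < \<rho>" "measure M (- J) < \<beta> n"
      "\<And>x x'. x \<in> J \<Longrightarrow> x' \<in> J \<Longrightarrow> dist x x' < \<rho> \<Longrightarrow> g (\<tau> x) = g (\<tau> x')"
      using lusin_finite_valued[OF comp fin sets _ g(1) \<beta>] by metis
    show ?thesis
    proof (intro exI conjI ballI impI)
      fix x x' assume "x \<in> J" "x' \<in> J" "dist x x' < 2 * (\<rho> / 2)"
      then show "dist (\<tau> x) (\<tau> x') < e n" using J(4) g(2) by simp
    qed (use J in auto)
  qed
  then show ?thesis by metis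
qed

section \<open>Transfer for pairs, relations and the standard superstructure\<close>

text \<open>
  Kuratowski pairs, and binary and ternary relations, for an arbitrary membership relation, so that the same formula
  describes them in the standard and in the nonstandard universe.
\<close>

definition is_pair :: "('m \<Rightarrow> 'm \<Rightarrow> bool) \<Rightarrow> 'm \<Rightarrow> 'm \<Rightarrow> 'm \<Rightarrow> bool" where
  "is_pair E p x y \<longleftrightarrow> (\<exists>a b. {z. E z p} = {a, b} \<and> {z. E z a} = {x} \<and> {z. E z b} = {x, y})"

definition rel2 :: "('m \<Rightarrow> 'm \<Rightarrow> bool) \<Rightarrow> 'm \<Rightarrow> 'm \<Rightarrow> 'm \<Rightarrow> bool" where
  "rel2 E R x y \<longleftrightarrow> (\<exists>p. E p R \<and> is_pair E p x y)"

definition rel3 :: "('m \<Rightarrow> 'm \<Rightarrow> bool) \<Rightarrow> 'm \<Rightarrow> 'm \<Rightarrow> 'm \<Rightarrow> 'm \<Rightarrow> bool" where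
  "rel3 E R x y z \<longleftrightarrow> (\<exists>q. is_pair E q x y \<and> rel2 E R q z)"

definition Disj :: "bformula \<Rightarrow> bformula \<Rightarrow> bformula" where
  "Disj \<phi> \<psi> = Neg (Conj (Neg \<phi>) (Neg \<psi>))"

definition Imp :: "bformula \<Rightarrow> bformula \<Rightarrow> bformula" where
  "Imp \<phi> \<psi> = Neg (Conj \<phi> (Neg \<psi>))"

definition BEx :: "nat \<Rightarrow> nat \<Rightarrow> bformula \<Rightarrow> bformula" where
  "BEx v b \<phi> = Neg (BAll v b (Neg \<phi>))"

text \<open>
  The variables 100 to 106 are reserved for the bound variables of these formulas. In every formula below, the
  variables starting from 0 stand for the standard parameters, in the order of the list
  that serves as the assignment, and larger numbers are bound.
\<close>

definition Pair2 :: "nat \<Rightarrow> nat \<Rightarrow> nat \<Rightarrow> bformula" where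
  "Pair2 p x y = BEx 100 p (BEx 101 p (Conj (BAll 102 p (Disj (Eq 102 100) (Eq 102 101)))
     (Conj (Conj (Mem x 100) (BAll 102 100 (Eq 102 x)))
       (Conj (Conj (Mem x 101) (Mem y 101)) (BAll 102 101 (Disj (Eq 102 x) (Eq 102 y)))))))"

definition Rel2 :: "nat \<Rightarrow> nat \<Rightarrow> nat \<Rightarrow> bformula" where
  "Rel2 R x y = BEx 103 R (Pair2 103 x y)"

definition Rel3 :: "nat \<Rightarrow> nat \<Rightarrow> nat \<Rightarrow> nat \<Rightarrow> bformula" where
  "Rel3 R x y z = BEx 104 R (BEx 105 104 (BEx 106 105 (Conj (Pair2 106 x y) (Pair2 104 106 z))))"

lemma sat_Disj [simp]: "sat E e (Disj \<phi> \<psi>) \<longleftrightarrow> sat E e \<phi> \<or> sat E e \<psi>"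
  by (simp add: Disj_def)

lemma sat_Imp [simp]: "sat E e (Imp \<phi> \<psi>) \<longleftrightarrow> (sat E e \<phi> \<longrightarrow> sat E e \<psi>)"
  by (simp add: Imp_def)

lemma sat_BEx [simp]: "sat E e (BEx v b \<phi>) \<longleftrightarrow> (\<exists>x. E x (e b) \<and> sat E (e(v := x)) \<phi>)"
  by (simp add: BEx_def)

lemma sat_Pair2 [simp]:
  assumes "p < 100 \<or> 102 < p" "x < 100 \<or> 102 < x" "y < 100 \<or> 102 < y"
  shows "sat E e (Pair2 p x y) \<longleftrightarrow> is_pair E (e p) (e x) (e y)"
proof -
  have neq: "p \<noteq> 100" "p \<noteq> 101" "p \<noteq> 102" "x \<noteq> 100" "x \<noteq> 101" "x \<noteq> 102" "y \<noteq> 100" "y \<noteq> 101" "y \<noteq> 102"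
    using assms by auto
  have two: "{z. E z c} = {u, v} \<longleftrightarrow> E u c \<and> E v c \<and> (\<forall>z. E z c \<longrightarrow> z = u \<or> z = v)" for c u v
    by blast
  have one: "{z. E z c} = {u} \<longleftrightarrow> E u c \<and> (\<forall>z. E z c \<longrightarrow> z = u)" for c u
    by blast
  show ?thesis
    unfolding Pair2_def is_pair_def two one using neq by simp
qed

lemma sat_Rel2 [simp]:
  assumes "R < 100" "x < 100 \<or> 103 < x" "y < 100 \<or> 103 < y"
  shows "sat E e (Rel2 R x y) \<longleftrightarrow> rel2 E (e R) (e x) (e y)"
  using assms by (auto simp: Rel2_def rel2_def)

lemma sat_Rel3 [simp]:
  assumes "R < 100" "x < 100" "y < 100" "z < 100"
  shows "sat E e (Rel3 R x y z) \<longleftrightarrow> rel3 E (e R) (e x) (e y) (e z)"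
proof -
  have "(\<exists>a. E a p \<and> E q a)" if "is_pair E p q (e z)" for p q
    using that unfolding is_pair_def by blast
  then show ?thesis using assms by (simp add: Rel3_def rel3_def rel2_def) meson
qed

text \<open>
  The components of a Kuratowski pair are determined by the elements of the pair and of its elements, which
  makes them unique for every membership relation, even one that is not extensional.
\<close>

lemma is_pair_unique:
  assumes "is_pair E p x y" "is_pair E p x' y'"
  shows "x = x' \<and> y = y'"
proof -
  obtain a b where ab: "{z. E z p} = {a, b}" "{z. E z a} = {x}" "{z. E z b} = {x, y}"
    using assms(1) unfolding is_pair_def by blast
  obtain c d where cd: "{z. E z p} = {c, d}" "{z. E z c} = {x'}" "{z. E z d} = {x', y'}"
    using assms(2) unfolding is_pair_def by blast
  have "(a = c \<and> b = d) \<or> (a = d \<and> b = c)" using ab(1) cd(1) by (auto simp: doubleton_eq_iff)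
  then show ?thesis using ab cd by (auto simp: doubleton_eq_iff)
qed

locale saturated_universe =
  fixes U :: "('a::metric_space, 'u, 'w) universe"
  assumes universe: "aleph1_saturated_universe U"
begin

lemma superstructure: "superstructure 20 U"
  using universe by (simp add: aleph1_saturated_universe_def)

lemma pt_base [simp]: "pt U x \<in> base U" and re_base [simp]: "re U r \<in> base U"
  using universe by (auto simp: aleph1_saturated_universe_def)

lemma pt_eq [simp]: "pt U x = pt U y \<longleftrightarrow> x = y" and re_eq [simp]: "re U r = re U s \<longleftrightarrow> r = s"
  using universe by (auto simp: aleph1_saturated_universe_def inj_eq)

lemma base_empty: "x \<in> base U \<Longrightarrow> \<not> mem U z x"
  using superstructure by (simp add: superstructure_def)

lemma extensionality: "x \<notin> base U \<Longrightarrow> y \<notin> base U \<Longrightarrow> {z. mem U z x} = {z. mem U z y} \<Longrightarrow> x = y"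
  using superstructure unfolding superstructure_def by blast

lemma transfer: "sat (mem U) ((!) cs) \<phi> \<Longrightarrow> sat (nmem U) (\<lambda>i. star U (cs ! i)) \<phi>"
  using universe unfolding aleph1_saturated_universe_def transfer_principle_def by blast

lemma transfer_iff: "sat (mem U) ((!) cs) \<phi> \<longleftrightarrow> sat (nmem U) (\<lambda>i. star U (cs ! i)) \<phi>"
  using universe unfolding aleph1_saturated_universe_def transfer_principle_def by blast

lemma level_mono: "m \<le> n \<Longrightarrow> level U m \<subseteq> level U n"
proof -
  have step: "level U n \<subseteq> level U (Suc n)" for n
    by (induction n) auto
  then show "m \<le> n \<Longrightarrow> level U m \<subseteq> level U n" by (rule lift_Suc_mono_le)
qed

lemma set_of_eq:
  assumes "A \<subseteq> level U n" "n < 20"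
  shows "set_of U A \<notin> base U" "{z. mem U z (set_of U A)} = A"
proof -
  obtain x where x: "x \<notin> base U \<and> {z. mem U z x} = A"
    using superstructure assms unfolding superstructure_def by meson
  have "set_of U A \<notin> base U \<and> {z. mem U z (set_of U A)} = A"
    unfolding set_of_def
  proof (rule theI[where P = "\<lambda>x. x \<notin> base U \<and> {z. mem U z x} = A", OF x])
    fix y assume "y \<notin> base U \<and> {z. mem U z y} = A"
    then show "y = x" using x extensionality[of y x] by simp
  qed
  then show "set_of U A \<notin> base U" "{z. mem U z (set_of U A)} = A" by auto
qed

lemma mem_set_of: "A \<subseteq> level U n \<Longrightarrow> n < 20 \<Longrightarrow> mem U z (set_of U A) \<longleftrightarrow> z \<in> A"
  using set_of_eq(2)[of A n] by blast

lemma set_of_level: "A \<subseteq> level U n \<Longrightarrow> n < 20 \<Longrightarrow> set_of U A \<in> level U (Suc n)"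
  using set_of_eq[of A n] by simp

lemma set_of_unique: "A \<subseteq> level U n \<Longrightarrow> n < 20 \<Longrightarrow> x \<notin> base U \<Longrightarrow> {z. mem U z x} = A \<Longrightarrow> x = set_of U A"
  using set_of_eq[of A n] by (intro extensionality) auto

lemma pair_level:
  assumes "x \<in> level U n" "y \<in> level U n" "n < 18"
  shows "pair U x y \<in> level U (Suc (Suc n))"
  unfolding pair_def using assms set_of_level[of "{x}" n] set_of_level[of "{x, y}" n]
  by (intro set_of_level) auto

lemma is_pair_iff:
  assumes "x \<in> level U n" "y \<in> level U n" "n < 18"
  shows "is_pair (mem U) p x y \<longleftrightarrow> p = pair U x y"
proof -
  have sub: "{x} \<subseteq> level U n" "{x, y} \<subseteq> level U n" "n < 20" using assms by auto
  have sub2: "{set_of U {x}, set_of U {x, y}} \<subseteq> level U (Suc n)"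
    using set_of_level[OF sub(1,3)] set_of_level[OF sub(2,3)] by auto
  show ?thesis
  proof
    assume "is_pair (mem U) p x y"
    then obtain a b where ab: "{z. mem U z p} = {a, b}" "{z. mem U z a} = {x}" "{z. mem U z b} = {x, y}"
      unfolding is_pair_def by blast
    have nb: "p \<notin> base U" "a \<notin> base U" "b \<notin> base U" using ab base_empty by fast+
    have "a = set_of U {x}" "b = set_of U {x, y}"
      using set_of_unique[OF sub(1,3) nb(2) ab(2)] set_of_unique[OF sub(2,3) nb(3) ab(3)] by auto
    then show "p = pair U x y"
      unfolding pair_def using set_of_unique[OF sub2 _ nb(1)] ab(1) assms(3) by simp
  next
    assume p: "p = pair U x y"
    have "{z. mem U z p} = {set_of U {x}, set_of U {x, y}}"
      using set_of_eq(2)[OF sub2] assms(3) by (simp add: p pair_def)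
    then show "is_pair (mem U) p x y"
      unfolding is_pair_def using set_of_eq(2)[OF sub(1,3)] set_of_eq(2)[OF sub(2,3)] by blast
  qed
qed

end

section \<open>Codes of standard sets, relations and functions\<close>

lemma is_pair_members:
  assumes "is_pair E p x y"
  shows "\<exists>a. E a p \<and> E x a" "\<exists>a. E a p \<and> E y a"
  using assms unfolding is_pair_def by blast+

lemma is_npair_eq: "is_npair U = is_pair (nmem U)"
  by (intro ext) (simp add: is_npair_def is_pair_def ext_def)

lemma nrel_eq: "nrel U = rel2 (nmem U)"
  by (intro ext) (auto simp: nrel_def rel2_def is_npair_eq ext_def)

declare level.simps(2) [simp del]

context saturated_universe
begin

lemma rel2_set_of_pairs:
  assumes "\<And>x y. P x y \<Longrightarrow> x \<in> level U n \<and> y \<in> level U n" and n: "n < 18"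
  shows "rel2 (mem U) (set_of U {pair U x y | x y. P x y}) x y \<longleftrightarrow> P x y"
proof -
  have "{pair U x y | x y. P x y} \<subseteq> level U (Suc (Suc n))" using assms pair_level by blast
  then have mem: "mem U p (set_of U {pair U x y | x y. P x y}) \<longleftrightarrow> (\<exists>x y. p = pair U x y \<and> P x y)" for p
    using mem_set_of[of _ "Suc (Suc n)" p] n by auto
  show ?thesis
  proof
    assume "rel2 (mem U) (set_of U {pair U x y | x y. P x y}) x y"
    then obtain x' y' where xy: "P x' y'" "is_pair (mem U) (pair U x' y') x y"
      unfolding rel2_def mem by blast
    then have "is_pair (mem U) (pair U x' y') x' y'" using is_pair_iff[of x' n y'] assms by blast
    then show "P x y" using xy is_pair_unique by metis
  next
    assume "P x y"
    then show "rel2 (mem U) (set_of U {pair U x y | x y. P x y}) x y"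
      unfolding rel2_def mem using is_pair_iff[of x n y] assms by blast
  qed
qed

lemma rel3_set_of_pairs:
  assumes P: "\<And>x y z. P x y z \<Longrightarrow> x \<in> level U n \<and> y \<in> level U n \<and> z \<in> level U (Suc (Suc n))" and n: "n < 16"
  shows "rel3 (mem U) (set_of U {pair U (pair U x y) z | x y z. P x y z}) x y z \<longleftrightarrow> P x y z"
proof -
  define Q where "Q q z \<longleftrightarrow> (\<exists>x y. q = pair U x y \<and> P x y z)" for q z
  have "{pair U (pair U x y) z | x y z. P x y z} = {pair U q z | q z. Q q z}" by (auto simp: Q_def)
  moreover have "q \<in> level U (Suc (Suc n)) \<and> z \<in> level U (Suc (Suc n))" if "Q q z" for q z
    using that P pair_level n unfolding Q_def by fastforce
  ultimately have "rel2 (mem U) (set_of U {pair U (pair U x y) z | x y z. P x y z}) q z \<longleftrightarrow> Q q z" for q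
    using rel2_set_of_pairs[of Q "Suc (Suc n)" q z] n by simp
  moreover have "(\<exists>q. is_pair (mem U) q x y \<and> Q q z) \<longleftrightarrow> P x y z"
  proof
    assume "\<exists>q. is_pair (mem U) q x y \<and> Q q z"
    then obtain x' y' where xy: "P x' y' z" "is_pair (mem U) (pair U x' y') x y" unfolding Q_def by blast
    then have "is_pair (mem U) (pair U x' y') x' y'" using is_pair_iff[of x' n y'] P n by simp
    then show "P x y z" using xy is_pair_unique by metis
  next
    assume "P x y z"
    then show "\<exists>q. is_pair (mem U) q x y \<and> Q q z"
      unfolding Q_def using is_pair_iff[of x n y] P n by auto
  qed
  ultimately show ?thesis by (simp add: rel3_def)
qed

text \<open>
  The formula quantifies over the elements of elements of the pairs in \<open>R\<close>, since bounded formulas cannot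
  quantify over the field of a relation.
\<close>

lemma star_functional2:
  assumes fn: "\<And>x y y'. rel2 (mem U) R x y \<Longrightarrow> rel2 (mem U) R x y' \<Longrightarrow> y = y'"
    and "rel2 (nmem U) (star U R) x y" "rel2 (nmem U) (star U R) x y'"
  shows "y = y'"
proof -
  let ?\<phi> = "BAll 1 0 (BAll 2 0 (BAll 3 1 (BAll 4 3 (BAll 5 1 (BAll 6 5 (BAll 7 2 (BAll 8 7
    (Imp (Conj (Pair2 1 4 6) (Pair2 2 4 8)) (Eq 6 8)))))))))"
  have "sat (mem U) ((!) [R]) ?\<phi>" using fn by (auto simp: rel2_def)
  from transfer[OF this]
  have *: "nmem U p1 (star U R) \<Longrightarrow> nmem U p2 (star U R) \<Longrightarrow> nmem U a p1 \<Longrightarrow> nmem U x a \<Longrightarrow>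
      nmem U b p1 \<Longrightarrow> nmem U y b \<Longrightarrow> nmem U b' p2 \<Longrightarrow> nmem U y' b' \<Longrightarrow>
      is_pair (nmem U) p1 x y \<Longrightarrow> is_pair (nmem U) p2 x y' \<Longrightarrow> y = y'" for p1 p2 a b b'
    by simp
  obtain p1 where 1: "nmem U p1 (star U R)" "is_pair (nmem U) p1 x y"
    using assms(2) by (auto simp: rel2_def)
  obtain p2 where 2: "nmem U p2 (star U R)" "is_pair (nmem U) p2 x y'"
    using assms(3) by (auto simp: rel2_def)
  obtain a b where 3: "nmem U a p1" "nmem U x a" "nmem U b p1" "nmem U y b"
    using is_pair_members[OF 1(2)] by blast
  obtain b' where 4: "nmem U b' p2" "nmem U y' b'" using is_pair_members[OF 2(2)] by blast
  show ?thesis by (rule *[OF 1(1) 2(1) 3 4 1(2) 2(2)])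
qed

lemma star_functional3:
  assumes fn: "\<And>x y z z'. rel3 (mem U) R x y z \<Longrightarrow> rel3 (mem U) R x y z' \<Longrightarrow> z = z'"
    and "rel3 (nmem U) (star U R) x y z" "rel3 (nmem U) (star U R) x y z'"
  shows "z = z'"
proof -
  let ?\<phi> = "BAll 1 0 (BAll 2 1 (BAll 3 2 (BAll 4 0 (BAll 5 4 (BAll 6 5
    (BAll 7 3 (BAll 8 7 (BAll 9 3 (BAll 10 9 (BAll 11 1 (BAll 12 11 (BAll 13 4 (BAll 14 13
    (Imp (Conj (Pair2 3 8 10) (Conj (Pair2 6 8 10) (Conj (Pair2 1 3 12) (Pair2 4 6 14))))
      (Eq 12 14)))))))))))))))"
  have "z = z'" if "is_pair (mem U) q1 x y" "is_pair (mem U) q2 x y" "mem U p1 R" "mem U p2 R"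
    "is_pair (mem U) p1 q1 z" "is_pair (mem U) p2 q2 z'" for x y z z' q1 q2 p1 p2
    by (rule fn[of x y]) (use that in \<open>auto simp: rel3_def rel2_def\<close>)
  then have "sat (mem U) ((!) [R]) ?\<phi>" by simp blast
  from transfer[OF this]
  have *: "nmem U p1 (star U R) \<Longrightarrow> nmem U a1 p1 \<Longrightarrow> nmem U q1 a1 \<Longrightarrow>
      nmem U p2 (star U R) \<Longrightarrow> nmem U a2 p2 \<Longrightarrow> nmem U q2 a2 \<Longrightarrow>
      nmem U c q1 \<Longrightarrow> nmem U x c \<Longrightarrow> nmem U d q1 \<Longrightarrow> nmem U y d \<Longrightarrow>
      nmem U b p1 \<Longrightarrow> nmem U z b \<Longrightarrow> nmem U b' p2 \<Longrightarrow> nmem U z' b' \<Longrightarrow>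
      is_pair (nmem U) q1 x y \<Longrightarrow> is_pair (nmem U) q2 x y \<Longrightarrow>
      is_pair (nmem U) p1 q1 z \<Longrightarrow> is_pair (nmem U) p2 q2 z' \<Longrightarrow> z = z'" for p1 a1 q1 p2 a2 q2 c d b b'
    by simp
  obtain q1 p1 where 1: "is_pair (nmem U) q1 x y" "nmem U p1 (star U R)" "is_pair (nmem U) p1 q1 z"
    using assms(2) by (auto simp: rel3_def rel2_def)
  obtain q2 p2 where 2: "is_pair (nmem U) q2 x y" "nmem U p2 (star U R)" "is_pair (nmem U) p2 q2 z'"
    using assms(3) by (auto simp: rel3_def rel2_def)
  obtain a1 b where 3: "nmem U a1 p1" "nmem U q1 a1" "nmem U b p1" "nmem U z b"
    using is_pair_members[OF 1(3)] by blast
  obtain a2 b' where 4: "nmem U a2 p2" "nmem U q2 a2" "nmem U b' p2" "nmem U z' b'"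
    using is_pair_members[OF 2(3)] by blast
  obtain c d where 5: "nmem U c q1" "nmem U x c" "nmem U d q1" "nmem U y d"
    using is_pair_members[OF 1(1)] by blast
  show ?thesis
    by (rule *[OF 1(2) 3(1,2) 2(2) 4(1,2) 5 3(3,4) 4(3,4) 1(1) 2(1) 1(3) 2(3)])
qed

lemma napp_star:
  assumes "\<And>x y y'. rel2 (mem U) R x y \<Longrightarrow> rel2 (mem U) R x y' \<Longrightarrow> y = y'"
    and "rel2 (nmem U) (star U R) x y"
  shows "napp U (star U R) x = y"
  unfolding napp_def nrel_eq
  using assms(2) star_functional2[OF assms(1)] by (intro the_equality) blast+

lemma napp2_star:
  assumes "\<And>x y z z'. rel3 (mem U) R x y z \<Longrightarrow> rel3 (mem U) R x y z' \<Longrightarrow> z = z'"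
    and "rel3 (nmem U) (star U R) x y z"
  shows "napp2 U (star U R) x y = z"
  unfolding napp2_def nrel_eq is_npair_eq
  using assms(2) star_functional3[OF assms(1)] by (intro the_equality) (auto simp: rel3_def)

text \<open>
  One set large enough to contain all points, reals, finite sets and graphs that occur, and low enough in the
  hierarchy for sets of pairs and triples of its elements to exist.
\<close>

definition universal_set :: "'u set" where
  "universal_set = level U 10"

definition set_code :: "'u set \<Rightarrow> 'u" where
  "set_code A = set_of U (A \<inter> universal_set)"

definition rel_code :: "('u \<Rightarrow> 'u \<Rightarrow> bool) \<Rightarrow> 'u" where
  "rel_code P = set_of U {pair U x y | x y. x \<in> universal_set \<and> y \<in> universal_set \<and> P x y}"

definition fin_code :: "'a set \<Rightarrow> 'u" where
  "fin_code F = set_of U (pt U ` F)"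

definition graph_code :: "('a \<Rightarrow> 'a) \<Rightarrow> 'a set \<Rightarrow> 'u" where
  "graph_code f F = set_of U ((\<lambda>z. pair U (pt U z) (pt U (f z))) ` F)"

lemma mem_set_code [simp]: "mem U z (set_code A) \<longleftrightarrow> z \<in> A \<and> z \<in> universal_set"
  unfolding set_code_def universal_set_def by (subst mem_set_of[of _ 10]) auto

lemma rel2_rel_code [simp]:
  "rel2 (mem U) (rel_code P) x y \<longleftrightarrow> x \<in> universal_set \<and> y \<in> universal_set \<and> P x y"
  unfolding rel_code_def universal_set_def by (rule rel2_set_of_pairs[of _ 10]) auto

lemma base_level: "x \<in> base U \<Longrightarrow> x \<in> level U n"
  using level_mono[of 0 n] by auto

lemma pt_level [simp]: "pt U x \<in> level U n" and re_level [simp]: "re U r \<in> level U n"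
  by (simp_all add: base_level)

lemma pt_universal [simp]: "pt U x \<in> universal_set" and re_universal [simp]: "re U r \<in> universal_set"
  by (simp_all add: universal_set_def)

lemma pt_image_subset: "pt U ` F \<subseteq> level U 0"
  by auto

lemma fin_code_base [simp]: "fin_code F \<notin> base U" and mem_fin_code [simp]: "mem U z (fin_code F) \<longleftrightarrow> z \<in> pt U ` F"
  and fin_code_level: "fin_code F \<in> level U (Suc 0)"
  using set_of_eq(1)[OF pt_image_subset] mem_set_of[OF pt_image_subset] set_of_level[OF pt_image_subset]
  unfolding fin_code_def by simp_all

lemma fin_code_universal [simp]: "fin_code F \<in> universal_set"
  using fin_code_level level_mono[of "Suc 0" 10] by (simp add: universal_set_def subset_iff)

lemma fin_code_eq [simp]: "fin_code A = fin_code B \<longleftrightarrow> A = B"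
proof
  assume *: "fin_code A = fin_code B"
  have "mem U (pt U x) (fin_code A) \<longleftrightarrow> mem U (pt U x) (fin_code B)" for x using * by simp
  then show "A = B" by (auto simp: image_iff)
qed simp

lemma graph_code_pairs: "graph_code f F = set_of U {pair U x y | x y. \<exists>z\<in>F. x = pt U z \<and> y = pt U (f z)}"
  unfolding graph_code_def by (rule arg_cong[of _ _ "set_of U"]) auto

lemma graph_code_subset: "(\<lambda>z. pair U (pt U z) (pt U (f z))) ` F \<subseteq> level U 2"
  using pair_level[of _ 0] by (auto simp: numeral_2_eq_2)

lemma graph_code_base [simp]: "graph_code f F \<notin> base U"
  and mem_graph_code: "mem U p (graph_code f F) \<longleftrightarrow> (\<exists>z\<in>F. p = pair U (pt U z) (pt U (f z)))"
  and graph_code_level: "graph_code f F \<in> level U 3"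
  using set_of_eq(1)[OF graph_code_subset] mem_set_of[OF graph_code_subset] set_of_level[OF graph_code_subset]
  unfolding graph_code_def by (simp_all add: eval_nat_numeral image_iff)

lemma graph_code_universal [simp]: "graph_code f F \<in> universal_set"
  using graph_code_level[of f F] level_mono[of 3 10] by (auto simp: universal_set_def)

lemma rel2_graph_code [simp]:
  "rel2 (mem U) (graph_code f F) x y \<longleftrightarrow> (\<exists>z\<in>F. x = pt U z \<and> y = pt U (f z))"
  unfolding graph_code_pairs by (rule rel2_set_of_pairs[of _ 0]) auto

text \<open>
  A code forgets the values of \<open>f\<close> outside the domain, and only those.
\<close>

lemma graph_code_eqD:
  assumes "graph_code f A = graph_code g B"
  shows "A = B" "\<And>x. x \<in> A \<Longrightarrow> f x = g x"
proof -
  have *: "(\<exists>z\<in>A. x = pt U z \<and> y = pt U (f z)) \<longleftrightarrow> (\<exists>z\<in>B. x = pt U z \<and> y = pt U (g z))" for x y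
    using assms rel2_graph_code by metis
  show "A = B"
  proof (rule set_eqI)
    fix x
    show "x \<in> A \<longleftrightarrow> x \<in> B"
      using *[of "pt U x" "pt U (f x)"] *[of "pt U x" "pt U (g x)"] by auto
  qed
  show "f x = g x" if "x \<in> A" for x
    using *[of "pt U x" "pt U (f x)"] that by auto
qed

lemma rel2_less_rel [simp]:
  "rel2 (mem U) (less_rel U) x y \<longleftrightarrow> (\<exists>a b. x = re U a \<and> y = re U b \<and> a < b)"
proof -
  have "less_rel U = set_of U {pair U x y | x y. \<exists>a b. x = re U a \<and> y = re U b \<and> a < b}"
    unfolding less_rel_def by (rule arg_cong[of _ _ "set_of U"]) auto
  then show ?thesis by (simp only:) (rule rel2_set_of_pairs[of _ 0], auto)
qed

lemma rel3_div_fun [simp]: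
  "rel3 (mem U) (div_fun U) x y z \<longleftrightarrow> (\<exists>a b. x = re U a \<and> y = re U b \<and> z = re U (a / b))"
proof -
  have "div_fun U = set_of U {pair U (pair U x y) z | x y z. \<exists>a b. x = re U a \<and> y = re U b \<and> z = re U (a / b)}"
    unfolding div_fun_def by (rule arg_cong[of _ _ "set_of U"]) blast
  then show ?thesis by (simp only:) (rule rel3_set_of_pairs[of _ 0], auto)
qed

lemma rel3_dist_fun [simp]:
  "rel3 (mem U) (dist_fun U) x y z \<longleftrightarrow> (\<exists>a b. x = pt U a \<and> y = pt U b \<and> z = re U (dist a b))"
proof -
  have "dist_fun U = set_of U {pair U (pair U x y) z | x y z. \<exists>a b. x = pt U a \<and> y = pt U b \<and> z = re U (dist a b)}"
    unfolding dist_fun_def by (rule arg_cong[of _ _ "set_of U"]) blast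
  then show ?thesis by (simp only:) (rule rel3_set_of_pairs[of _ 0], auto)
qed

lemma rel2_card_fun [simp]:
  "rel2 (mem U) (card_fun U) x y \<longleftrightarrow> (\<exists>F. finite F \<and> x = fin_code F \<and> y = re U (real (card F)))"
proof -
  have "card_fun U = set_of U {pair U x y | x y. \<exists>F. finite F \<and> x = fin_code F \<and> y = re U (real (card F))}"
    unfolding card_fun_def fin_code_def by (rule arg_cong[of _ _ "set_of U"]) auto
  then show ?thesis
    by (simp only:) (rule rel2_set_of_pairs[of _ "Suc 0"], auto simp: fin_code_level)
qed

lemma rel3_orbit_fun [simp]:
  "rel3 (mem U) (orbit_fun U) t x c \<longleftrightarrow> (\<exists>F f a. finite F \<and> bij_betw f F F \<and> a \<in> F \<and>
     t = graph_code f F \<and> x = pt U a \<and> c = fin_code (orbit_of f a))"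
proof -
  have "orbit_fun U = set_of U {pair U (pair U t x) c | t x c. \<exists>F f a. finite F \<and> bij_betw f F F \<and> a \<in> F \<and>
     t = graph_code f F \<and> x = pt U a \<and> c = fin_code (orbit_of f a)}"
    unfolding orbit_fun_def orbit_of_def fin_code_def graph_code_def
    by (rule arg_cong[of _ _ "set_of U"]) blast
  moreover have "fin_code F \<in> level U (Suc (Suc 3))" for F
    using fin_code_level level_mono[of "Suc 0" "Suc (Suc 3)"] by auto
  ultimately show ?thesis
    by (simp only:) (rule rel3_set_of_pairs[of _ 3], auto simp: graph_code_level)
qed

lemma fin_sets_eq: "fin_sets U = set_code {fin_code F | F. finite F}"
  unfolding fin_sets_def set_code_def
  by (rule arg_cong[of _ _ "set_of U"]) (auto simp: fin_code_def[symmetric])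

end

section \<open>Standard parts of points\<close>

context saturated_universe
begin

definition points :: 'u where "points = set_code (range (pt U))"
definition reals :: 'u where "reals = set_code (range (re U))"

definition pt_rel :: "('a \<Rightarrow> 'a \<Rightarrow> bool) \<Rightarrow> 'u" where
  "pt_rel P = rel_code (\<lambda>x y. \<exists>a b. x = pt U a \<and> y = pt U b \<and> P a b)"

definition star_pt_rel :: "('a \<Rightarrow> 'a \<Rightarrow> bool) \<Rightarrow> 'w \<Rightarrow> 'w \<Rightarrow> bool" where
  "star_pt_rel P = rel2 (nmem U) (star U (pt_rel P))"

lemma mem_points [simp]: "mem U x points \<longleftrightarrow> (\<exists>a. x = pt U a)"
  and mem_reals [simp]: "mem U x reals \<longleftrightarrow> (\<exists>a. x = re U a)"
  by (auto simp: points_def reals_def)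

lemma rel2_pt_rel [simp]: "rel2 (mem U) (pt_rel P) x y \<longleftrightarrow> (\<exists>a b. x = pt U a \<and> y = pt U b \<and> P a b)"
  by (auto simp: pt_rel_def)

lemma star_pt_point: "nmem U (star U (pt U a)) (star U points)"
  using transfer[of "[pt U a, points]" "Mem 0 1"] by simp

lemma star_pt_rel_points:
  assumes "star_pt_rel P x y"
  shows "nmem U x (star U points)" "nmem U y (star U points)"
proof -
  obtain p where p: "nmem U p (star U (pt_rel P))" "is_pair (nmem U) p x y"
    using assms by (auto simp: star_pt_rel_def rel2_def)
  obtain a b where ab: "nmem U a p" "nmem U x a" "nmem U b p" "nmem U y b"
    using is_pair_members[OF p(2)] by blast
  have std: "(\<exists>a. x = pt U a) \<and> (\<exists>a. y = pt U a)" if "mem U p (pt_rel P)" "is_pair (mem U) p x y" for p x y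
    using that rel2_pt_rel[of P x y] by (auto simp: rel2_def)
  let ?\<phi> = "BAll 2 0 (BAll 3 2 (BAll 4 3 (BAll 5 2 (BAll 6 5
    (Imp (Pair2 2 4 6) (Conj (Mem 4 1) (Mem 6 1)))))))"
  have "sat (mem U) ((!) [pt_rel P, points]) ?\<phi>" using std by simp
  from transfer[OF this] show "nmem U x (star U points)" "nmem U y (star U points)"
    using p ab by auto
qed

lemma star_pt_rel_star: "star_pt_rel P (star U (pt U a)) (star U (pt U b)) \<longleftrightarrow> P a b"
  using transfer_iff[of "[pt_rel P, pt U a, pt U b]" "Rel2 0 1 2"]
  by (simp add: star_pt_rel_def)

lemma star_pt_rel_comp:
  assumes "\<And>x y z. P x y \<Longrightarrow> Q y z \<Longrightarrow> R x z" and "star_pt_rel P x y" "star_pt_rel Q y z"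
  shows "star_pt_rel R x z"
proof -
  let ?\<phi> = "BAll 4 3 (BAll 5 3 (BAll 6 3 (Imp (Conj (Rel2 0 4 5) (Rel2 1 5 6)) (Rel2 2 4 6))))"
  have "sat (mem U) ((!) [pt_rel P, pt_rel Q, pt_rel R, points]) ?\<phi>" using assms(1) by auto
  from transfer[OF this] show ?thesis
    using assms(2,3) star_pt_rel_points[OF assms(2)] star_pt_rel_points[OF assms(3)]
    by (simp add: star_pt_rel_def)
qed

lemma star_pt_rel_at:
  assumes "\<And>y z. P y z \<Longrightarrow> Q y a \<Longrightarrow> R z b" and "star_pt_rel P y z" "star_pt_rel Q y (star U (pt U a))"
  shows "star_pt_rel R z (star U (pt U b))"
proof -
  let ?\<phi> = "BAll 6 3 (BAll 7 3 (Imp (Conj (Rel2 0 6 7) (Rel2 1 6 4)) (Rel2 2 7 5)))"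
  have "sat (mem U) ((!) [pt_rel P, pt_rel Q, pt_rel R, points, pt U a, pt U b]) ?\<phi>"
    using assms(1) by auto
  from transfer[OF this] show ?thesis
    using assms(2,3) star_pt_rel_points[OF assms(2)] by (simp add: star_pt_rel_def)
qed

lemma star_pt_rel_mono_at:
  assumes "\<And>y. P y a \<Longrightarrow> Q y a" and "star_pt_rel P y (star U (pt U a))"
  shows "star_pt_rel Q y (star U (pt U a))"
proof -
  let ?\<phi> = "BAll 4 2 (Imp (Rel2 0 4 3) (Rel2 1 4 3))"
  have "sat (mem U) ((!) [pt_rel P, pt_rel Q, points, pt U a]) ?\<phi>" using assms(1) by auto
  from transfer[OF this] show ?thesis
    using assms(2) star_pt_rel_points[OF assms(2)] by (simp add: star_pt_rel_def)
qed

lemma star_pt_rel_sym: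
  assumes "\<And>x y. P x y \<Longrightarrow> Q y x" and "star_pt_rel P x y"
  shows "star_pt_rel Q y x"
proof -
  let ?\<phi> = "BAll 3 2 (BAll 4 2 (Imp (Rel2 0 3 4) (Rel2 1 4 3)))"
  have "sat (mem U) ((!) [pt_rel P, pt_rel Q, points]) ?\<phi>" using assms(1) by auto
  from transfer[OF this] show ?thesis
    using assms(2) star_pt_rel_points[OF assms(2)] by (simp add: star_pt_rel_def)
qed

text \<open>
  The distance function disappears here: from now on, nearness is expressed by the standard
  relations \<open>dist a b < e\<close> only.
\<close>

lemma near_iff:
  assumes "nmem U \<xi> (star U points)" "nmem U \<eta> (star U points)"
  shows "near U \<xi> \<eta> \<longleftrightarrow> (\<forall>e>0. star_pt_rel (\<lambda>a b. dist a b < e) \<xi> \<eta>)"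
proof -
  let ?\<phi> = "BAll 3 0 (BAll 4 0 (BEx 5 1 (Rel3 2 3 4 5)))"
  have "sat (mem U) ((!) [points, reals, dist_fun U]) ?\<phi>" by auto
  from transfer[OF this] obtain d where d: "nmem U d (star U reals)" "rel3 (nmem U) (star U (dist_fun U)) \<xi> \<eta> d"
    using assms by auto
  have app: "napp2 U (star U (dist_fun U)) \<xi> \<eta> = d"
    by (rule napp2_star[OF _ d(2)]) auto
  have less: "star_pt_rel (\<lambda>a b. dist a b < e) \<xi> \<eta> \<longleftrightarrow>
      rel2 (nmem U) (star U (less_rel U)) (star U (re U (0 - e))) d \<and>
      rel2 (nmem U) (star U (less_rel U)) d (star U (re U (0 + e)))" if "0 < e" for e :: real
  proof -
    let ?P = "pt_rel (\<lambda>a b. dist a b < e)"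
    let ?\<psi> = "BAll 10 0 (BAll 11 0 (BAll 12 1 (Imp (Rel3 2 10 11 12)
      (Conj (Imp (Rel2 3 10 11) (Conj (Rel2 4 5 12) (Rel2 4 12 6)))
        (Imp (Conj (Rel2 4 5 12) (Rel2 4 12 6)) (Rel2 3 10 11))))))"
    have pos: "- e < dist x y" for x y :: 'a using that zero_le_dist[of x y] by linarith
    have "sat (mem U) ((!) [points, reals, dist_fun U, ?P, less_rel U, re U (0 - e), re U (0 + e)]) ?\<psi>"
      using pos by (simp, intro allI impI, elim exE conjE, simp)
    note star = transfer[OF this, simplified]
    show ?thesis
      using star[THEN spec, THEN mp, OF assms(1), THEN spec, THEN mp, OF assms(2), THEN spec, THEN mp, OF d(1)] d(2)
      unfolding star_pt_rel_def diff_0 add_0 by blast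
  qed
  show ?thesis
    unfolding near_def near_real_def app nrel_eq using less by blast
qed

lemma star_fin_code:
  assumes "finite K" "nmem U w (star U (fin_code K))"
  shows "\<exists>k\<in>K. w = star U (pt U k)"
  using assms
proof (induction K arbitrary: w)
  case empty
  have "sat (mem U) ((!) [fin_code {}]) (BAll 1 0 (Neg (Eq 1 1)))" by simp
  from transfer[OF this] show ?case using empty by simp
next
  case (insert k K)
  have "sat (mem U) ((!) [fin_code (insert k K), fin_code K, pt U k]) (BAll 3 0 (Disj (Eq 3 2) (Mem 3 1)))"
    by auto
  from transfer[OF this] have "w = star U (pt U k) \<or> nmem U w (star U (fin_code K))"
    using insert.prems by simp
  then show ?case using insert.IH by blast
qed

text \<open>
  If every standard point \<open>x\<close> had a ball \<open>*ball x (e x)\<close> that misses \<open>\<xi>\<close>, finitely many of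
  these balls would cover the space, and by transfer one of them would contain \<open>\<xi>\<close>.
\<close>

lemma ex_near_standard:
  assumes comp: "compact (UNIV :: 'a set)" and \<xi>: "nmem U \<xi> (star U points)"
  shows "\<exists>x. near U \<xi> (star U (pt U x))"
proof (rule ccontr)
  assume "\<not> ?thesis"
  then have "\<forall>x. \<exists>e>0. \<not> star_pt_rel (\<lambda>a b. dist a b < e) \<xi> (star U (pt U x))"
    using near_iff[OF \<xi> star_pt_point] by blast
  then obtain e where e: "\<And>x. 0 < e x" "\<And>x. \<not> star_pt_rel (\<lambda>a b. dist a b < e x) \<xi> (star U (pt U x))"
    by metis
  have cover: "UNIV \<subseteq> (\<Union>x. ball x (e x))"
  proof
    fix x show "x \<in> (\<Union>x. ball x (e x))" using e(1)[of x] by (intro UN_I[of x]) auto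
  qed
  obtain K where K: "finite K" "UNIV \<subseteq> (\<Union>x\<in>K. ball x (e x))"
    using compactE_image[OF comp open_ball cover] by metis
  let ?P = "\<lambda>a b. dist a b < e b"
  have "\<exists>k\<in>K. dist x k < e k" for x
    using K(2) by (force simp: dist_commute)
  then have "sat (mem U) ((!) [points, fin_code K, pt_rel ?P]) (BAll 3 0 (BEx 4 1 (Rel2 2 3 4)))"
    by fastforce
  from transfer[OF this] obtain w where w: "nmem U w (star U (fin_code K))" "star_pt_rel ?P \<xi> w"
    using \<xi> by (auto simp: star_pt_rel_def)
  then obtain k where k: "star_pt_rel ?P \<xi> (star U (pt U k))" using star_fin_code[OF K(1)] by blast
  have "star_pt_rel (\<lambda>a b. dist a b < e k) \<xi> (star U (pt U k))"
    by (rule star_pt_rel_mono_at[OF _ k])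
  then show False using e(2) by blast
qed

lemma st_unique:
  assumes "near U \<xi> (star U (pt U x))" "near U \<xi> (star U (pt U y))" "nmem U \<xi> (star U points)"
  shows "x = y"
proof (rule ccontr)
  assume "x \<noteq> y"
  define e where "e = dist x y / 2"
  have "0 < e" using \<open>x \<noteq> y\<close> by (simp add: e_def)
  then have x: "star_pt_rel (\<lambda>a b. dist a b < e) \<xi> (star U (pt U x))"
    and y: "star_pt_rel (\<lambda>a b. dist a b < e) \<xi> (star U (pt U y))"
    using assms near_iff[OF assms(3) star_pt_point] by blast+
  have "star_pt_rel (\<lambda>a b. dist a b < e) (star U (pt U x)) \<xi>"
    by (rule star_pt_rel_sym[OF _ x]) (simp add: dist_commute)
  then have "star_pt_rel (\<lambda>a b. dist a b < 2 * e) (star U (pt U x)) (star U (pt U y))"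
  proof (rule star_pt_rel_comp[rotated, OF _ y])
    fix u v w :: 'a assume "dist u v < e" "dist v w < e"
    then show "dist u w < 2 * e" using dist_triangle[of u w v] by linarith
  qed
  then show False by (simp add: star_pt_rel_star e_def)
qed

lemma near_st:
  assumes "compact (UNIV :: 'a set)" "nmem U \<xi> (star U points)"
  shows "near U \<xi> (star U (pt U (st U \<xi>)))"
proof -
  obtain x where x: "near U \<xi> (star U (pt U x))" using ex_near_standard[OF assms] by blast
  have "st U \<xi> = x" unfolding st_def
    by (rule the_equality[where P = "\<lambda>x. near U \<xi> (star U (pt U x))", OF x])
      (rule st_unique[OF _ x assms(2)])
  then show ?thesis using x by simp
qed

end

section \<open>Hyperfinite sets and standard parts of hyperreals\<close>

context saturated_universe
begin

definition fin_where :: "('a set \<Rightarrow> bool) \<Rightarrow> 'u" where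
  "fin_where H = set_code {fin_code F | F. finite F \<and> H F}"

definition fin_rel :: "('a set \<Rightarrow> 'a set \<Rightarrow> bool) \<Rightarrow> 'u" where
  "fin_rel P = rel_code (\<lambda>x y. \<exists>A B. finite A \<and> finite B \<and> x = fin_code A \<and> y = fin_code B \<and> P A B)"

lemma mem_fin_where [simp]: "mem U x (fin_where H) \<longleftrightarrow> (\<exists>F. x = fin_code F \<and> finite F \<and> H F)"
  by (auto simp: fin_where_def)

lemma rel2_fin_rel [simp]: "rel2 (mem U) (fin_rel P) x y \<longleftrightarrow>
    (\<exists>A B. finite A \<and> finite B \<and> x = fin_code A \<and> y = fin_code B \<and> P A B)"
  by (auto simp: fin_rel_def)

lemma mem_fin_sets [simp]: "mem U x (fin_sets U) \<longleftrightarrow> (\<exists>F. x = fin_code F \<and> finite F)"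
  by (auto simp: fin_sets_eq)

lemma mem_set_of_base [simp]: "mem U x (set_of U (base U)) \<longleftrightarrow> x \<in> base U"
  by (rule mem_set_of[of _ 0]) auto

lemma hyperfinite_iff: "hyperfinite U Y \<longleftrightarrow> nmem U Y (star U (fin_sets U))"
  by (simp add: hyperfinite_def ext_def)

lemma internal_hyperfinite:
  assumes "hyperfinite U B"
  shows "internal_set U B"
proof -
  have "sat (mem U) ((!) [fin_sets U, set_of U (base U)]) (BAll 3 0 (Neg (Mem 3 1)))" by auto
  note star = transfer[OF this, simplified]
  show ?thesis
    using star assms unfolding hyperfinite_iff internal_set_def internal_def ext_def by blast
qed

lemma hyperfinite_points:
  assumes "hyperfinite U Y" "y \<in> ext U Y"
  shows "nmem U y (star U points)"
proof -
  have "sat (mem U) ((!) [fin_sets U, points]) (BAll 2 0 (BAll 3 2 (Mem 3 1)))" by auto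
  from transfer[OF this] show ?thesis using assms by (simp add: hyperfinite_iff ext_def)
qed

abbreviation star_less :: "'w \<Rightarrow> 'w \<Rightarrow> bool" where
  "star_less \<equiv> rel2 (nmem U) (star U (less_rel U))"

lemma star_less_trans:
  assumes "nmem U q (star U reals)" "a < b"
  shows "star_less (star U (re U b)) q \<Longrightarrow> star_less (star U (re U a)) q"
    and "\<not> star_less (star U (re U a)) q \<Longrightarrow> star_less q (star U (re U b))"
proof -
  let ?\<phi> = "BAll 4 0 (Conj (Imp (Rel2 1 3 4) (Rel2 1 2 4)) (Disj (Rel2 1 2 4) (Rel2 1 4 3)))"
  have "sat (mem U) ((!) [reals, less_rel U, re U a, re U b]) ?\<phi>" using assms(2) by auto
  note star = transfer[OF this, simplified]
  show "star_less (star U (re U b)) q \<Longrightarrow> star_less (star U (re U a)) q"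
    "\<not> star_less (star U (re U a)) q \<Longrightarrow> star_less q (star U (re U b))"
    using star[THEN spec, THEN mp, OF assms(1)] by blast+
qed

lemma star_less_asym:
  assumes "nmem U q (star U reals)" "star_less q (star U (re U a))"
  shows "\<not> star_less (star U (re U a)) q"
proof -
  have "sat (mem U) ((!) [reals, less_rel U, re U a]) (BAll 4 0 (Imp (Rel2 1 4 2) (Neg (Rel2 1 2 4))))"
    by auto
  note star = transfer[OF this, simplified]
  show ?thesis using star[THEN spec, THEN mp, OF assms(1)] assms(2) by blast
qed

text \<open>
  A bounded hyperreal is infinitely close to the supremum of the standard reals below it.
\<close>

lemma near_st_real:
  assumes q: "nmem U q (star U reals)"
    and lo: "star_less (star U (re U a)) q" and hi: "\<not> star_less (star U (re U b)) q"
  shows "near_real U q (st_real U q)"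
proof -
  let ?S = "{s. star_less (star U (re U s)) q}"
  have up: "s \<le> b" if "s \<in> ?S" for s
    using that hi star_less_trans(1)[OF q, of b s] by (cases "b < s") auto
  have bdd: "bdd_above ?S" using up by (auto simp: bdd_above_def)
  have ex: "near_real U q (Sup ?S)"
    unfolding near_real_def nrel_eq
  proof (intro allI impI conjI)
    fix e :: real assume "0 < e"
    obtain s where s: "s \<in> ?S" "Sup ?S - e < s"
      using less_cSup_iff[of ?S "Sup ?S - e"] lo bdd \<open>0 < e\<close> by auto
    then show "star_less (star U (re U (Sup ?S - e))) q" using star_less_trans(1)[OF q s(2)] by simp
    have "\<not> star_less (star U (re U (Sup ?S + e / 2))) q"
      using cSup_upper[OF _ bdd, of "Sup ?S + e / 2"] \<open>0 < e\<close> by auto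
    then show "star_less q (star U (re U (Sup ?S + e)))"
      using star_less_trans(2)[OF q, of "Sup ?S + e / 2" "Sup ?S + e"] \<open>0 < e\<close> by simp
  qed
  have uniq: "r \<le> s" if "near_real U q r" "near_real U q s" for r s
  proof (rule ccontr)
    assume "\<not> r \<le> s"
    define e where "e = (r - s) / 2"
    have e: "0 < e" "r - e = s + e" using \<open>\<not> r \<le> s\<close> by (auto simp: e_def field_simps)
    have "star_less (star U (re U (r - e))) q" "star_less q (star U (re U (s + e)))"
      using that e(1) unfolding near_real_def nrel_eq by blast+
    then show False using star_less_asym[OF q] e(2) by simp
  qed
  show ?thesis
    unfolding st_real_def by (rule theI[where P = "near_real U q", OF ex]) (use uniq ex in \<open>auto intro: antisym\<close>)
qed

lemma st_real_le:
  assumes "near_real U q (st_real U q)" "\<not> star_less (star U (re U r)) q"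
  shows "st_real U q \<le> r"
proof (rule ccontr)
  assume "\<not> st_real U q \<le> r"
  then have "star_less (star U (re U (st_real U q - (st_real U q - r)))) q"
    using assms(1) unfolding near_real_def nrel_eq by (metis diff_gt_0_iff_gt not_le)
  then show False using assms(2) by simp
qed

lemma st_real_nonneg:
  assumes "nmem U q (star U reals)" "near_real U q (st_real U q)" "\<not> star_less q (star U (re U 0))"
  shows "0 \<le> st_real U q"
proof (rule ccontr)
  assume "\<not> 0 \<le> st_real U q"
  then have "star_less q (star U (re U (st_real U q + (- st_real U q))))"
    using assms(2) unfolding near_real_def nrel_eq by (metis neg_0_less_iff_less not_le)
  then show False using assms(3) by simp
qed

definition loeb_content :: "'w \<Rightarrow> 'w \<Rightarrow> real" where
  "loeb_content Y B = st_real U (napp2 U (star U (div_fun U)) (ncard U B) (ncard U Y))"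

text \<open>
  The condition that the share of \<open>B\<close> in \<open>F\<close> exceeds \<open>r\<close>, without division. Its nonstandard extension is all that later
  proofs need to know about hyperreal cardinalities.
\<close>

definition dense_in :: "real \<Rightarrow> 'a set \<Rightarrow> 'a set \<Rightarrow> bool" where
  "dense_in r B F \<longleftrightarrow> r * real (card F) < real (card B)"

text \<open>
  One transferred formula collects what is true of the quotient of the cardinalities of finite sets
  \<open>A \<subseteq> F\<close>: it exists, lies in the unit interval, and exceeds \<open>s\<close> only if \<open>dense_in s A F\<close>.
\<close>

lemma loeb_content_le:
  assumes Y: "hyperfinite U Y" and B: "hyperfinite U B" "ext U B \<subseteq> ext U Y" and "ext U Y \<noteq> {}"
  shows "0 \<le> loeb_content Y B"
    and "\<not> rel2 (nmem U) (star U (fin_rel (dense_in r))) B Y \<Longrightarrow> loeb_content Y B \<le> r"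
proof -
  have bounds: "\<not> real (card A) / real (card F) < 0" "- 1 < real (card A) / real (card F)"
    "A \<subseteq> F \<Longrightarrow> finite F \<Longrightarrow> \<not> 1 < real (card A) / real (card F)" for A F :: "'a set"
  proof -
    show *: "\<not> real (card A) / real (card F) < 0" by (simp add: not_less)
    then show "- 1 < real (card A) / real (card F)" by linarith
    assume "A \<subseteq> F" "finite F"
    then have "card A \<le> card F" by (rule card_mono[rotated])
    then show "\<not> 1 < real (card A) / real (card F)" by (simp add: divide_simps not_less)
  qed
  have ratio: "dense_in s A F" if "finite F" "F \<noteq> {}" "s < real (card A) / real (card F)"
    for A F :: "'a set" and s
    using that by (simp add: dense_in_def field_simps card_gt_0_iff)
  have key: "\<exists>q. nmem U q (star U reals) \<and> napp2 U (star U (div_fun U)) (ncard U B) (ncard U Y) = q \<and>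
    \<not> star_less q (star U (re U 0)) \<and> star_less (star U (re U (- 1))) q \<and> \<not> star_less (star U (re U 1)) q \<and>
    (star_less (star U (re U s)) q \<longrightarrow> rel2 (nmem U) (star U (fin_rel (dense_in s))) B Y)" for s
  proof -
    (* The second conjunct of the premise says that the larger set is nonempty, so its cardinality is a proper divisor. *)
    let ?\<phi> = "BAll 20 0 (BAll 21 0 (Imp (Conj (BAll 22 21 (Mem 22 20)) (BEx 22 20 (Eq 22 22)))
      (BEx 23 1 (BEx 24 1 (BEx 25 1 (Conj (Conj (Rel2 2 21 23) (Rel2 2 20 24)) (Conj (Rel3 3 23 24 25)
       (Conj (Neg (Rel2 4 25 5)) (Conj (Rel2 4 6 25) (Conj (Neg (Rel2 4 7 25))
         (Imp (Rel2 4 8 25) (Rel2 9 21 20))))))))))))"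
    let ?cs = "[fin_sets U, reals, card_fun U, div_fun U, less_rel U, re U 0, re U (- 1), re U 1, re U s,
      fin_rel (dense_in s)]"
    have "sat (mem U) ((!) ?cs) ?\<phi>"
    proof (simp, intro allI impI, elim exE conjE, hypsubst, goal_cases)
      case (1 _ _ F A z)
      have AF: "A \<subseteq> F" "F \<noteq> {}" using 1 by (auto simp: image_iff)
      note facts = bounds(1)[of A F] bounds(2)[of A F] bounds(3)[OF AF(1) 1(3)] ratio[OF 1(3) AF(2), of s A]
      show ?case
        using facts 1(3,4)
        by (intro exI[of _ "re U (real (card A))"] exI[of _ "re U (real (card F))"]
            exI[of _ "re U (real (card A) / real (card F))"] conjI) auto
    qed
    note star = transfer[OF this, simplified]
    have "\<forall>z. nmem U z B \<longrightarrow> nmem U z Y" "\<exists>z. nmem U z Y"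
      using B(2) \<open>ext U Y \<noteq> {}\<close> by (auto simp: ext_def)
    then obtain b y q where q: "nmem U q (star U reals)"
      "rel2 (nmem U) (star U (card_fun U)) B b" "rel2 (nmem U) (star U (card_fun U)) Y y"
      "rel3 (nmem U) (star U (div_fun U)) b y q" and *: "\<not> star_less q (star U (re U 0))"
      "star_less (star U (re U (- 1))) q" "\<not> star_less (star U (re U 1)) q"
      "star_less (star U (re U s)) q \<longrightarrow> rel2 (nmem U) (star U (fin_rel (dense_in s))) B Y"
      using star[THEN spec, THEN mp, OF Y[unfolded hyperfinite_iff], THEN spec, THEN mp,
          OF B(1)[unfolded hyperfinite_iff]] by blast
    have "ncard U B = b" "ncard U Y = y"
      unfolding ncard_def by (rule napp_star[OF _ q(2)] napp_star[OF _ q(3)]; auto)+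
    moreover have "napp2 U (star U (div_fun U)) b y = q" by (rule napp2_star[OF _ q(4)]) auto
    ultimately show ?thesis using q(1) * by blast
  qed
  show "0 \<le> loeb_content Y B"
    unfolding loeb_content_def using key near_st_real st_real_nonneg by metis
  assume not: "\<not> rel2 (nmem U) (star U (fin_rel (dense_in r))) B Y"
  obtain q where q: "nmem U q (star U reals)" "napp2 U (star U (div_fun U)) (ncard U B) (ncard U Y) = q"
    "star_less (star U (re U (- 1))) q" "\<not> star_less (star U (re U 1)) q"
    "star_less (star U (re U r)) q \<longrightarrow> rel2 (nmem U) (star U (fin_rel (dense_in r))) B Y"
    using key by blast
  show "loeb_content Y B \<le> r"
    unfolding loeb_content_def q(2) using near_st_real[OF q(1,3,4)] by (rule st_real_le) (use q(5) not in blast)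
qed

end

section \<open>Loeb measure\<close>

context saturated_universe
begin

lemma space_loeb: "space (loeb U Y) = ext U Y"
  unfolding loeb_def by (simp add: space_extend_measure subset_eq)

text \<open>
  Since the total mass is not zero, \<open>extend_measure\<close> has found a measure that extends the content on internal sets;
  otherwise it would return the null measure.
\<close>

lemma loeb_internal:
  assumes pos: "emeasure (loeb U Y) (ext U Y) \<noteq> 0"
    and B: "internal_set U B" "ext U B \<subseteq> ext U Y"
  shows "ext U B \<in> sets (loeb U Y)" "emeasure (loeb U Y) (ext U B) = ennreal (loeb_content Y B)"
proof -
  let ?I = "{B. internal_set U B \<and> ext U B \<subseteq> ext U Y}"
  let ?c = "\<lambda>B. ennreal (loeb_content Y B)"
  define M where "M = extend_measure (ext U Y) ?I (ext U) ?c"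
  have L: "loeb U Y = completion M" by (simp add: loeb_def M_def loeb_content_def)
  have sub: "ext U ` ?I \<subseteq> Pow (ext U Y)" by auto
  have setsM: "sets M = sigma_sets (ext U Y) (ext U ` ?I)" unfolding M_def by (rule sets_extend_measure[OF sub])
  have BM: "ext U B \<in> sets M" using B setsM by auto
  have "emeasure M (ext U Y) \<noteq> 0"
    using pos sets.top[of M] space_extend_measure[OF sub, of ?c] by (simp add: L M_def)
  (* Some measure has the prescribed values, for otherwise M is the null measure. *)
  have ex: "\<exists>\<mu>'. (\<forall>i\<in>?I. \<mu>' (ext U i) = ?c i) \<and> measure_space (ext U Y) (sigma_sets (ext U Y) (ext U ` ?I)) \<mu>'"
  proof (rule ccontr)
    assume "\<not> ?thesis"
    then have "M = measure_of (ext U Y) (ext U ` ?I) (\<lambda>_. 0)"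
      unfolding M_def extend_measure_def by auto
    then have "emeasure M (ext U Y) = 0" by (simp add: emeasure_measure_of_conv)
    then show False using \<open>emeasure M (ext U Y) \<noteq> 0\<close> by simp
  qed
  then obtain \<mu>' where \<mu>': "\<And>i. i \<in> ?I \<Longrightarrow> \<mu>' (ext U i) = ?c i"
    "measure_space (ext U Y) (sigma_sets (ext U Y) (ext U ` ?I)) \<mu>'" by blast
  have "emeasure M (ext U B) = ?c B"
    using \<mu>' B by (intro emeasure_extend_measure[OF M_def \<mu>'(1) sub])
      (auto simp: setsM measure_space_def)
  then show "emeasure (loeb U Y) (ext U B) = ennreal (loeb_content Y B)" using BM by (simp add: L)
  show "ext U B \<in> sets (loeb U Y)" using BM by (simp add: L)
qed

end

locale hyperfinite_approximation = saturated_universe U + prob_space \<nu>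
  for U :: "('a::metric_space, 'u, 'w) universe" and \<nu> :: "'a measure" +
  fixes Y :: 'w
  assumes compact_space: "compact (UNIV :: 'a set)" and sets_\<nu>: "sets \<nu> = sets borel"
    and approx: "hf_approx_space U \<nu> Y"
begin

abbreviation L :: "'w measure" where "L \<equiv> loeb U Y"

lemma space_\<nu>: "space \<nu> = UNIV"
  using sets_eq_imp_space_eq[OF sets_\<nu>] by simp

lemma hyperfinite_Y: "hyperfinite U Y" and st_measurable: "st U \<in> measurable L \<nu>" and distr_st: "distr L \<nu> (st U) = \<nu>"
  using approx by (auto simp: hf_approx_space_def measure_preserving_def)

lemma emeasure_st: "A \<in> sets \<nu> \<Longrightarrow> emeasure L (st U -` A \<inter> ext U Y) = emeasure \<nu> A"
  using emeasure_distr[OF st_measurable, of A] by (simp add: distr_st space_loeb)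

lemma prob_space_L: "prob_space L"
proof
  show "emeasure L (space L) = 1"
    using emeasure_st[of UNIV] emeasure_space_1 sets.top[of \<nu>] by (simp add: space_\<nu> space_loeb)
qed

lemma Y_nonempty: "ext U Y \<noteq> {}"
  using prob_space.not_empty[OF prob_space_L] by (simp add: space_loeb)

lemma measure_internal:
  assumes "hyperfinite U B" "ext U B \<subseteq> ext U Y"
  shows "ext U B \<in> sets L" "measure L (ext U B) = loeb_content Y B"
proof -
  have pos: "emeasure L (ext U Y) \<noteq> 0"
    using prob_space.emeasure_space_1[OF prob_space_L] by (simp add: space_loeb)
  note * = loeb_internal[OF pos internal_hyperfinite[OF assms(1)] assms(2)]
  show "ext U B \<in> sets L" by (rule *(1))
  show "measure L (ext U B) = loeb_content Y B"
    using *(2) loeb_content_le(1)[OF hyperfinite_Y assms Y_nonempty] by (simp add: measure_def)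
qed

lemma measure_le_of_not_dense:
  assumes "hyperfinite U B" "ext U B \<subseteq> ext U Y" "\<not> rel2 (nmem U) (star U (fin_rel (dense_in r))) B Y"
  shows "measure L (ext U B) \<le> r"
  using measure_internal(2)[OF assms(1,2)] loeb_content_le(2)[OF hyperfinite_Y assms(1,2) Y_nonempty assms(3)]
  by simp

lemma Y_star: "nmem U Y (star U (fin_sets U))"
  using hyperfinite_Y by (simp add: hyperfinite_iff)

lemma near_st_Y: "y \<in> ext U Y \<Longrightarrow> near U y (star U (pt U (st U y)))"
  by (rule near_st[OF compact_space hyperfinite_points[OF hyperfinite_Y]])

lemma near_st_Y_dist: "y \<in> ext U Y \<Longrightarrow> 0 < e \<Longrightarrow> star_pt_rel (\<lambda>a b. dist a b < e) y (star U (pt U (st U y)))"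
  using near_st_Y near_iff[OF hyperfinite_points[OF hyperfinite_Y] star_pt_point] by blast

text \<open>
  The standard part map pulls the open set \<open>S\<close> back into the internal set \<open>B = Y \<inter> *S\<close>, because an open
  set contains a standard ball around each of its points. So \<open>B\<close> has Loeb measure at
  least the measure of \<open>S\<close>, which exceeds \<open>r\<close>.
\<close>

lemma open_counts:
  assumes S: "open S" "r < measure \<nu> S"
  shows "nmem U Y (star U (fin_where (\<lambda>F. finite F \<and> F \<noteq> {} \<and> r * real (card F) < real (card (F \<inter> S)))))"
proof -
  let ?H = "\<lambda>F. finite F \<and> F \<noteq> {} \<and> r * real (card F) < real (card (F \<inter> S))"
  let ?S = "set_code (pt U ` S)"
  let ?\<phi> = "BAll 10 0 (BEx 11 0 (Conj (BAll 12 11 (Mem 12 10))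
    (Conj (BAll 12 10 (Imp (Mem 12 1) (Mem 12 11)))
      (Imp (Conj (BEx 12 10 (Eq 12 12)) (Rel2 2 11 10)) (Mem 10 3)))))"
  have "sat (mem U) ((!) [fin_sets U, ?S, fin_rel (dense_in r), fin_where ?H]) ?\<phi>"
  proof (simp, intro allI impI, elim exE conjE, hypsubst, goal_cases)
    case (1 _ F)
    then show ?case
      by (intro exI[of _ "fin_code (F \<inter> S)"] conjI) (auto simp: dense_in_def)
  qed
  note star = transfer[OF this, simplified]
  obtain B where B: "hyperfinite U B" "ext U B \<subseteq> ext U Y"
    "\<And>z. z \<in> ext U Y \<Longrightarrow> nmem U z (star U ?S) \<Longrightarrow> z \<in> ext U B"
    "rel2 (nmem U) (star U (fin_rel (dense_in r))) B Y \<Longrightarrow> nmem U Y (star U (fin_where ?H))"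
    using star[THEN spec, THEN mp, OF Y_star] Y_nonempty unfolding hyperfinite_iff ext_def by blast
  have "st U -` S \<inter> ext U Y \<subseteq> ext U B"
  proof
    fix y assume y: "y \<in> st U -` S \<inter> ext U Y"
    then obtain e where e: "0 < e" "ball (st U y) e \<subseteq> S" using S(1) openE by blast
    let ?\<psi> = "BAll 4 0 (Imp (Rel2 1 4 2) (Mem 4 3))"
    have "sat (mem U) ((!) [points, pt_rel (\<lambda>a b. dist a b < e), pt U (st U y), ?S]) ?\<psi>"
      using e(2) by (auto simp: dist_commute subset_iff)
    note star = transfer[OF this, simplified]
    have "nmem U y (star U ?S)"
      using star y near_st_Y_dist[of y, OF _ e(1)] hyperfinite_points[OF hyperfinite_Y, of y]
      by (simp add: star_pt_rel_def)
    then show "y \<in> ext U B" using B(3) y by blast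
  qed
  then have "measure L (st U -` S \<inter> ext U Y) \<le> measure L (ext U B)"
    using measure_internal(1)[OF B(1,2)] prob_space_L
    by (intro finite_measure.finite_measure_mono prob_space.finite_measure)
  moreover have "measure L (st U -` S \<inter> ext U Y) = measure \<nu> S"
    using emeasure_st[of S] S(1) by (simp add: measure_def sets_\<nu>)
  ultimately have "\<not> measure L (ext U B) \<le> r" using S(2) by simp
  then show ?thesis using measure_le_of_not_dense[OF B(1,2)] B(4) by blast
qed

text \<open>
  The properties \<open>H\<close> of finite sets with \<open>Y \<in> *H\<close> form a filter. By \<open>open_counts\<close> it is finer than each principal
  filter in the definition of \<open>uniform_near\<close>, hence finer than their infimum.
\<close>

lemma star_of_eventually:
  assumes "eventually H (uniform_near \<nu>)"
  shows "nmem U Y (star U (fin_where H))"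
proof -
  let ?P = "\<lambda>H. nmem U Y (star U (fin_where H))"
  have conj: "?P (\<lambda>F. H F \<and> G F)" if "?P H" "?P G" for H G
  proof -
    have "sat (mem U) ((!) [fin_where H, fin_where G, fin_where (\<lambda>F. H F \<and> G F)])
        (BAll 3 0 (Imp (Mem 3 1) (Mem 3 2)))" by auto
    note star = transfer[OF this, simplified]
    show ?thesis using star that by blast
  qed
  have mono: "?P G" if "\<forall>F. H F \<longrightarrow> G F" "?P H" for H G
  proof -
    have "sat (mem U) ((!) [fin_where H, fin_where G]) (BAll 2 0 (Mem 2 1))" using that(1) by auto
    note star = transfer[OF this, simplified]
    show ?thesis using star that(2) by blast
  qed
  have "?P (\<lambda>_. True)"
    using Y_star by (simp add: fin_sets_eq fin_where_def)
  then have filt: "is_filter ?P" using conj mono by unfold_locales auto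
  have ev: "eventually H (Abs_filter ?P) \<longleftrightarrow> ?P H" for H by (rule eventually_Abs_filter[OF filt])
  have "Abs_filter ?P \<le> uniform_near \<nu>"
    unfolding uniform_near_def
  proof (rule INF_greatest)
    fix p :: "'a set \<times> real" assume "p \<in> {(S, r). open S \<and> r < prob S}"
    then show "Abs_filter ?P \<le> (case p of (S, r) \<Rightarrow>
        principal {F. finite F \<and> F \<noteq> {} \<and> r * real (card F) < real (card (F \<inter> S))})"
      using open_counts by (auto simp: le_principal ev)
  qed
  then show ?thesis using assms ev by (simp add: le_filter_def)
qed

end

section \<open>Internal permutations and saturation\<close>

context saturated_universe
begin

text \<open>
  The relation between the graph of a permutation and its domain. Many functions \<open>f\<close>
  have the same graph on \<open>F\<close>; one of them has to satisfy \<open>Q\<close>.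
\<close>

definition perm_rel :: "(('a \<Rightarrow> 'a) \<Rightarrow> 'a set \<Rightarrow> bool) \<Rightarrow> 'u" where
  "perm_rel Q = rel_code (\<lambda>x y. \<exists>f F. finite F \<and> bij_betw f F F \<and> x = graph_code f F \<and> y = fin_code F \<and> Q f F)"

definition star_perm :: "(('a \<Rightarrow> 'a) \<Rightarrow> 'a set \<Rightarrow> bool) \<Rightarrow> 'w \<Rightarrow> 'w \<Rightarrow> bool" where
  "star_perm Q T Y \<longleftrightarrow> nmem U Y (star U (fin_sets U)) \<and> nmem U T (star U (set_code UNIV)) \<and>
     rel2 (nmem U) (star U (perm_rel Q)) T Y"

lemma rel2_perm_rel [simp]: "rel2 (mem U) (perm_rel Q) x y \<longleftrightarrow>
    (\<exists>f F. finite F \<and> bij_betw f F F \<and> x = graph_code f F \<and> y = fin_code F \<and> Q f F)"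
  by (auto simp: perm_rel_def)

lemma star_perm_mono:
  assumes "\<And>f F. Q f F \<Longrightarrow> Q' f F" and "star_perm Q T Y"
  shows "star_perm Q' T Y"
proof -
  have "sat (mem U) ((!) [fin_sets U, set_code UNIV, perm_rel Q, perm_rel Q'])
      (BAll 10 0 (BAll 11 1 (Imp (Rel2 2 11 10) (Rel2 3 11 10))))"
    using assms(1) by fastforce
  note star = transfer[OF this, simplified]
  show ?thesis using star assms(2) unfolding star_perm_def by blast
qed

text \<open>
  Comprehension in the standard universe, transferred: the section of \<open>perm_rel Q\<close> over a finite set is a standard set of
  level 11, and its nonstandard counterpart is an internal set.
\<close>

lemma ex_internal_set_of_perms:
  assumes "nmem U Y (star U (fin_where (\<lambda>F. \<exists>f. bij_betw f F F \<and> Q f F)))"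
  shows "\<exists>S. internal_set U S \<and> ext U S = {T. star_perm Q T Y} \<and> ext U S \<noteq> {}"
proof -
  let ?sets = "set_of U (level U 11)"
  have sets: "mem U x ?sets \<longleftrightarrow> x \<in> level U 11" for x by (rule mem_set_of[of _ 11]) auto
  let ?\<phi> = "BAll 10 0 (Conj (Mem 10 1) (BEx 11 2 (Conj (Neg (Mem 11 3)) (Conj
    (BAll 12 11 (Conj (Mem 12 4) (Rel2 5 12 10))) (Conj (BAll 12 4 (Imp (Rel2 5 12 10) (Mem 12 11)))
      (BEx 12 11 (Eq 12 12)))))))"
  have "sat (mem U) ((!) [fin_where (\<lambda>F. \<exists>f. bij_betw f F F \<and> Q f F), fin_sets U, ?sets,
      set_of U (base U), set_code UNIV, perm_rel Q]) ?\<phi>"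
  proof (simp add: sets, intro allI impI, elim exE conjE, hypsubst, goal_cases)
    case (1 _ F f)
    (* The section over F is a subset of level 10 and therefore an element of level 11. *)
    let ?A = "{t. t \<in> universal_set \<and> rel2 (mem U) (perm_rel Q) t (fin_code F)}"
    have A: "?A \<subseteq> level U 10" by (auto simp: universal_set_def)
    have "mem U t (set_of U ?A) \<longleftrightarrow> t \<in> ?A" for t by (rule mem_set_of[OF A]) simp
    moreover have "set_of U ?A \<notin> base U" by (rule set_of_eq(1)[OF A]) simp
    moreover have "set_of U ?A \<in> level U 11" using set_of_level[OF A] by (simp add: eval_nat_numeral)
    ultimately show ?case
      using 1 by (auto intro!: exI[of "\<lambda>S. S \<in> level U 11 \<and> _ S" "set_of U ?A"]
        exI[of "\<lambda>t. t \<in> universal_set \<and> _ t" "graph_code f F"])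
  qed
  note star = transfer[OF this, simplified]
  show ?thesis
    using star[THEN spec, THEN mp, OF assms]
    unfolding internal_set_def internal_def ext_def star_perm_def by blast
qed

text \<open>
  For a decreasing sequence, nonempty members already have the finite intersection property.
\<close>

lemma saturation_decseq:
  assumes "\<And>n. internal_set U (S n)" "\<And>n. ext U (S n) \<noteq> {}" "\<And>m n. m \<le> n \<Longrightarrow> ext U (S n) \<subseteq> ext U (S m)"
  shows "\<exists>x. \<forall>n::nat. x \<in> ext U (S n)"
proof -
  have "aleph1_saturated U" using universe by (simp add: aleph1_saturated_universe_def)
  moreover have "(\<Inter>A\<in>G. ext U A) \<noteq> {}" if G: "finite G" "G \<subseteq> range S" for G
  proof -
    obtain I where I: "finite I" "G = S ` I" using finite_subset_image[OF G] by blast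
    have "ext U (S (Max (insert 0 I))) \<subseteq> ext U (S i)" if "i \<in> I" for i
      using assms(3) I(1) that by simp
    then show ?thesis using assms(2)[of "Max (insert 0 I)"] I(2) by fast
  qed
  ultimately have "(\<Inter>A\<in>range S. ext U A) \<noteq> {}"
    using assms(1) unfolding aleph1_saturated_def by (metis countableI_type countable_image rangeE)
  then show ?thesis by auto
qed

lemma star_perm_internal:
  assumes "star_perm Q T Y"
  shows "internal_set U T"
proof -
  have "sat (mem U) ((!) [fin_sets U, set_code UNIV, perm_rel Q, set_of U (base U)])
      (BAll 10 0 (BAll 11 1 (Imp (Rel2 2 11 10) (Neg (Mem 11 3)))))" by auto
  note star = transfer[OF this, simplified]
  show ?thesis using star assms unfolding star_perm_def internal_set_def internal_def ext_def by blast
qed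

lemma star_perm_bij:
  assumes "star_perm Q T Y"
  shows "\<And>p. p \<in> ext U T \<Longrightarrow> \<exists>x\<in>ext U Y. \<exists>y\<in>ext U Y. is_npair U p x y"
    and "\<And>x. x \<in> ext U Y \<Longrightarrow> \<exists>y. nrel U T x y"
    and "\<And>x y y'. nrel U T x y \<Longrightarrow> nrel U T x y' \<Longrightarrow> y = y'"
    and "\<And>x x' y. nrel U T x y \<Longrightarrow> nrel U T x' y \<Longrightarrow> x = x'"
    and "\<And>y. y \<in> ext U Y \<Longrightarrow> \<exists>x. nrel U T x y"
    and "\<And>x y. nrel U T x y \<Longrightarrow> x \<in> ext U Y \<and> y \<in> ext U Y"
proof -
  note YT = assms[unfolded star_perm_def, THEN conjunct1] assms[unfolded star_perm_def, THEN conjunct2, THEN conjunct1]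
    assms[unfolded star_perm_def, THEN conjunct2, THEN conjunct2]
  have pair: "is_pair (mem U) (pair U (pt U x) (pt U y)) (pt U x) (pt U y)" for x y
    by (subst is_pair_iff[of _ 0]) auto
  have pair_eq: "is_pair (mem U) (pair U (pt U x) (pt U y)) (pt U a) (pt U b) \<longleftrightarrow> x = a \<and> y = b" for x y a b
    using pair is_pair_unique[OF pair[of x y], of "pt U a" "pt U b"] by auto
  have "sat (mem U) ((!) [fin_sets U, set_code UNIV, perm_rel Q]) (BAll 10 0 (BAll 11 1 (Imp (Rel2 2 11 10)
      (BAll 12 11 (BEx 13 10 (BEx 14 10 (Pair2 12 13 14)))))))"
    by (auto simp: mem_graph_code pair_eq) (meson bij_betwE)
  note star = transfer[OF this, simplified]
  have pairs: "\<exists>x\<in>ext U Y. \<exists>y\<in>ext U Y. is_npair U p x y" if "p \<in> ext U T" for p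
    using star[THEN spec, THEN mp, OF YT(1), THEN spec, THEN mp, OF YT(2), THEN mp, OF YT(3)] that
    unfolding ext_def is_npair_eq by auto
  then show "\<And>p. p \<in> ext U T \<Longrightarrow> \<exists>x\<in>ext U Y. \<exists>y\<in>ext U Y. is_npair U p x y" by blast
  have "x \<in> ext U Y \<and> y \<in> ext U Y" if xy: "nrel U T x y" for x y
  proof -
    obtain p where p: "p \<in> ext U T" "is_npair U p x y" using xy by (auto simp: nrel_def)
    then obtain x' y' where "x' \<in> ext U Y" "y' \<in> ext U Y" "is_npair U p x' y'" using pairs by blast
    then show ?thesis using p(2) is_pair_unique unfolding is_npair_eq by metis
  qed
  then show in_Y: "\<And>x y. nrel U T x y \<Longrightarrow> x \<in> ext U Y \<and> y \<in> ext U Y" by blast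
  let ?\<phi> = "BAll 10 0 (BAll 11 1 (Imp (Rel2 2 11 10)
     (Conj (BAll 12 10 (BEx 13 10 (Rel2 11 12 13)))
     (Conj (BAll 12 10 (BAll 13 10 (BAll 14 10 (Imp (Conj (Rel2 11 12 13) (Rel2 11 12 14)) (Eq 13 14)))))
     (Conj (BAll 12 10 (BAll 13 10 (BAll 14 10 (Imp (Conj (Rel2 11 13 12) (Rel2 11 14 12)) (Eq 13 14)))))
       (BAll 12 10 (BEx 13 10 (Rel2 11 13 12))))))))"
  have "sat (mem U) ((!) [fin_sets U, set_code UNIV, perm_rel Q]) ?\<phi>"
  proof (simp, intro allI impI, elim exE conjE, hypsubst, goal_cases)
    case (1 _ _ F' f F)
    have f: "bij_betw f F F" and F': "F' = F" using 1 by auto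
    have "f y \<in> F" "\<exists>x\<in>F. y = f x" if "y \<in> F" for y
      using f that by (auto simp: bij_betw_def)
    moreover have "inj_on f F" using f by (auto simp: bij_betw_def)
    ultimately show ?case unfolding F' by (auto simp: inj_on_def)
  qed
  note star = transfer[OF this, simplified]
  note star' = star[THEN spec, THEN mp, OF YT(1), THEN spec, THEN mp, OF YT(2), THEN mp, OF YT(3), folded nrel_eq]
  show "\<And>x. x \<in> ext U Y \<Longrightarrow> \<exists>y. nrel U T x y" "\<And>y. y \<in> ext U Y \<Longrightarrow> \<exists>x. nrel U T x y"
    using star' unfolding ext_def by blast+
  have uniq: "x \<in> ext U Y \<Longrightarrow> y \<in> ext U Y \<Longrightarrow> y' \<in> ext U Y \<Longrightarrow>
      nrel U T x y \<Longrightarrow> nrel U T x y' \<Longrightarrow> y = y'"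
    "x \<in> ext U Y \<Longrightarrow> y \<in> ext U Y \<Longrightarrow> y' \<in> ext U Y \<Longrightarrow>
      nrel U T y x \<Longrightarrow> nrel U T y' x \<Longrightarrow> y = y'" for x y y'
    using star' unfolding ext_def mem_Collect_eq by meson+
  show "y = y'" if "nrel U T x y" "nrel U T x y'" for x y y'
    using uniq(1)[OF _ _ _ that] in_Y[OF that(1)] in_Y[OF that(2)] by simp
  show "x = x'" if "nrel U T x y" "nrel U T x' y" for x x' y
    using uniq(2)[OF _ _ _ that] in_Y[OF that(1)] in_Y[OF that(2)] by simp
qed

lemma star_perm_nrel_napp: "star_perm Q T Y \<Longrightarrow> nrel U T x y \<Longrightarrow> napp U T x = y"
  unfolding napp_def using star_perm_bij(3) by (intro the_equality) blast+

lemma star_perm_internal_permutation: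
  assumes "star_perm Q T Y"
  shows "internal_permutation U Y T"
proof -
  note bij = star_perm_bij[OF assms] and app = star_perm_nrel_napp[OF assms]
  have "bij_betw (napp U T) (ext U Y) (ext U Y)"
    unfolding bij_betw_def
  proof
    show "inj_on (napp U T) (ext U Y)"
    proof (rule inj_onI)
      fix x x' assume "x \<in> ext U Y" "x' \<in> ext U Y" and eq: "napp U T x = napp U T x'"
      then obtain y y' where "nrel U T x y" "nrel U T x' y'" using bij(2) by blast
      then show "x = x'" using app eq bij(4) by metis
    qed
    show "napp U T ` ext U Y = ext U Y"
    proof
      show "napp U T ` ext U Y \<subseteq> ext U Y" using bij(2,6) app by (metis image_subsetI)
      show "ext U Y \<subseteq> napp U T ` ext U Y" using bij(5,6) app by (metis image_eqI subsetI)
    qed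
  qed
  moreover have "\<exists>!y. nrel U T x y" if "x \<in> ext U Y" for x
    using bij(2)[OF that] bij(3) by blast
  ultimately show ?thesis
    unfolding internal_permutation_def using star_perm_internal[OF assms] bij(1) by blast
qed

text \<open>
  The value of the standard orbit function at a cyclic permutation and a point is the domain itself, so the internal
  orbit is \<open>Y\<close> itself.
\<close>

lemma star_perm_transitive:
  assumes "star_perm (\<lambda>f F. \<exists>x\<in>F. orbit_of f x = F) T Y"
  shows "transitive_permutation U Y T"
proof -
  let ?Q = "\<lambda>f F. \<exists>x\<in>F. orbit_of f x = F"
  (* The graph code determines the permutation on its domain, hence the orbit. *)
  have fn: "c = c'" if R: "rel3 (mem U) (orbit_fun U) t x c" "rel3 (mem U) (orbit_fun U) t x c'" for t x c c'
  proof -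
    obtain F f a where 1: "bij_betw f F F" "a \<in> F" "t = graph_code f F" "x = pt U a" "c = fin_code (orbit_of f a)"
      using R(1) unfolding rel3_orbit_fun by blast
    obtain F' f' a' where 2: "t = graph_code f' F'" "x = pt U a'" "c' = fin_code (orbit_of f' a')"
      using R(2) unfolding rel3_orbit_fun by blast
    have "a' = a" using 1 2 by simp
    have f: "f' z = f z" if "z \<in> F" for z using graph_code_eqD[of f F f' F'] 1 2 that by simp
    have "(f' ^^ k) a = (f ^^ k) a \<and> (f ^^ k) a \<in> F" for k
      using 1(1,2) f by (induction k) (auto simp: bij_betw_def)
    then have "orbit_of f' a = orbit_of f a" by (simp add: orbit_of_def)
    then show ?thesis using 1 2 \<open>a' = a\<close> by simp
  qed
  have "sat (mem U) ((!) [fin_sets U, set_code UNIV, perm_rel ?Q, orbit_fun U])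
      (BAll 10 0 (BAll 11 1 (Imp (Rel2 2 11 10) (BEx 12 10 (Rel3 3 11 12 10)))))"
  proof (simp, intro allI impI, elim exE conjE bexE, hypsubst, goal_cases)
    case (1 _ _ F f _ x)
    have "finite F" "bij_betw f F F" "x \<in> F" and F: "orbit_of f x = F" using 1 by auto
    then show ?case unfolding F
      by (intro exI[of _ "pt U x"] conjI exI[of _ F] exI[of _ f] exI[of _ x]) (auto simp: F)
  qed
  note star = transfer[OF this, simplified]
  then obtain y where y: "y \<in> ext U Y" "rel3 (nmem U) (star U (orbit_fun U)) T y Y"
    using assms unfolding star_perm_def ext_def by blast
  have "internal_orbit U T y = Y" unfolding internal_orbit_def by (rule napp2_star[OF fn y(2)])
  then show ?thesis
    using y(1) star_perm_internal_permutation[OF assms] unfolding transitive_permutation_def by metis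
qed

lemma star_perm_bad_set:
  assumes "star_perm Q T Y"
    and Q: "\<And>f F. Q f F \<Longrightarrow> real (card {y \<in> F. \<not> P y (f y)}) \<le> r * real (card F)"
  shows "\<exists>E. hyperfinite U E \<and> ext U E \<subseteq> ext U Y \<and> \<not> rel2 (nmem U) (star U (fin_rel (dense_in r))) E Y \<and>
    (\<forall>y\<in>ext U Y - ext U E. star_pt_rel P y (napp U T y))"
proof -
  let ?\<phi> = "BAll 10 0 (BAll 11 1 (Imp (Rel2 2 11 10) (BEx 12 0 (Conj (BAll 13 12 (Mem 13 10))
    (Conj (Neg (Rel2 3 12 10)) (BAll 13 10 (Imp (Neg (Mem 13 12))
      (BEx 14 10 (Conj (Rel2 11 13 14) (Rel2 4 13 14))))))))))"
  have "sat (mem U) ((!) [fin_sets U, set_code UNIV, perm_rel Q, fin_rel (dense_in r), pt_rel P]) ?\<phi>"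
  proof (simp, intro allI impI, elim exE conjE, hypsubst, goal_cases)
    case (1 _ _ F' f F)
    let ?E = "{y \<in> F. \<not> P y (f y)}"
    have f: "bij_betw f F F" "Q f F" and fin: "finite F" and F': "F' = F" using 1 by auto
    have "\<not> dense_in r ?E F" using Q[OF f(2)] by (simp add: dense_in_def)
    moreover have "f y \<in> F" if "y \<in> F" for y using bij_betwE[OF f(1)] that by blast
    ultimately show ?case unfolding F' using fin
      by (intro exI[of _ "fin_code ?E"] conjI) auto
  qed
  note star = transfer[OF this, simplified]
  then obtain E where E: "hyperfinite U E" "ext U E \<subseteq> ext U Y"
    "\<not> rel2 (nmem U) (star U (fin_rel (dense_in r))) E Y"
    and P: "\<And>y. y \<in> ext U Y \<Longrightarrow> y \<notin> ext U E \<Longrightarrow> \<exists>z. nrel U T y z \<and> star_pt_rel P y z"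
    using assms(1) unfolding star_perm_def ext_def hyperfinite_iff nrel_eq star_pt_rel_def by blast
  show ?thesis
  proof (intro exI[of _ E] conjI ballI E)
    fix y assume "y \<in> ext U Y - ext U E"
    then obtain z where "nrel U T y z" "star_pt_rel P y z" using P by blast
    then show "star_pt_rel P y (napp U T y)" using star_perm_nrel_napp[OF assms(1)] by simp
  qed
qed

end

section \<open>The lifting theorem\<close>

context hyperfinite_approximation
begin

lemma ex_transitive_approximation:
  assumes na: "nonatomic \<nu>" and \<tau>: "measure_preserving \<nu> \<nu> \<tau>"
  shows "\<exists>T. hf_approx_system U \<nu> \<tau> Y T \<and> transitive_permutation U Y T"
proof -
  have "\<tau> \<in> measurable \<nu> \<nu>" using \<tau> by (simp add: measure_preserving_def)
  then have "\<exists>K d. \<forall>n. closed (K n) \<and> 0 < d n \<and> prob (- K n) < (1 / 2) ^ n \<and>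
      (\<forall>x\<in>K n. \<forall>x'\<in>K n. dist x x' < 2 * d n \<longrightarrow> dist (\<tau> x) (\<tau> x') < 1 / real (Suc n))"
    by (rule lusin_sequence[OF compact_space finite_measure_axioms sets_\<nu>]) auto
  then obtain K d where Kd: "\<And>n. closed (K n) \<and> 0 < d n \<and> prob (- K n) < (1 / 2) ^ n \<and>
      (\<forall>x\<in>K n. \<forall>x'\<in>K n. dist x x' < 2 * d n \<longrightarrow> dist (\<tau> x) (\<tau> x') < 1 / real (Suc n))"
    by blast
  have K: "closed (K n)" and d: "0 < d n" and small: "prob (- K n) < (1 / 2) ^ n" for n
    using Kd[of n] by auto
  have lusin: "dist (\<tau> x) (\<tau> x') < 1 / real (Suc n)" if "x \<in> K n" "x' \<in> K n" "dist x x' < 2 * d n" for n x x'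
    using Kd[of n] that by blast
  define P where "P n = near_graph \<tau> (K n) (d n) (1 / real (Suc n))" for n
  define Q where "Q N f F \<longleftrightarrow> (\<exists>x\<in>F. orbit_of f x = F) \<and>
      (\<forall>n\<le>N. real (card {y \<in> F. \<not> P n y (f y)}) \<le> (1 / 2) ^ n * real (card F))" for N f F
  have "eventually (\<lambda>F. \<exists>f x. x \<in> F \<and> bij_betw f F F \<and> orbit_of f x = F \<and>
      (\<forall>n\<le>N. real (card {y \<in> F. \<not> P n y (f y)}) \<le> (1 / 2) ^ n * real (card F))) (uniform_near \<nu>)" for N
    unfolding P_def
    by (rule eventually_cyclic_permutation[OF compact_space prob_space_axioms sets_\<nu> na \<tau>])
      (use K d small in auto)
  then have "eventually (\<lambda>F. \<exists>f. bij_betw f F F \<and> Q N f F) (uniform_near \<nu>)" for N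
    by (rule eventually_mono) (auto simp: Q_def)
  then have "\<exists>S. internal_set U S \<and> ext U S = {T. star_perm (Q N) T Y} \<and> ext U S \<noteq> {}" for N
    by (intro ex_internal_set_of_perms star_of_eventually)
  then obtain S where S: "\<And>N. internal_set U (S N)" "\<And>N. ext U (S N) = {T. star_perm (Q N) T Y}"
    "\<And>N. ext U (S N) \<noteq> {}" by metis
  have "ext U (S n) \<subseteq> ext U (S m)" if "m \<le> n" for m n
    unfolding S(2) using that by (auto intro!: star_perm_mono[of "Q n" "Q m"] simp: Q_def)
  then obtain T where T: "\<And>n. star_perm (Q n) T Y"
    using saturation_decseq[of S] S by blast
  have "star_perm (\<lambda>f F. \<exists>x\<in>F. orbit_of f x = F) T Y"
    by (rule star_perm_mono[OF _ T[of 0]]) (simp add: Q_def)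
  then have trans: "transitive_permutation U Y T" by (rule star_perm_transitive)
  have "\<exists>E. hyperfinite U E \<and> ext U E \<subseteq> ext U Y \<and>
      \<not> rel2 (nmem U) (star U (fin_rel (dense_in ((1 / 2) ^ n)))) E Y \<and>
      (\<forall>y\<in>ext U Y - ext U E. star_pt_rel (P n) y (napp U T y))" for n
    by (rule star_perm_bad_set[OF T[of n]]) (simp add: Q_def)
  then obtain E where E: "\<And>n. hyperfinite U (E n)" "\<And>n. ext U (E n) \<subseteq> ext U Y"
    "\<And>n. \<not> rel2 (nmem U) (star U (fin_rel (dense_in ((1 / 2) ^ n)))) (E n) Y"
    and good: "\<And>n y. y \<in> ext U Y \<Longrightarrow> y \<notin> ext U (E n) \<Longrightarrow> star_pt_rel (P n) y (napp U T y)"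
    by (metis DiffI)
  interpret L: prob_space L by (rule prob_space_L)
  have summ: "summable (\<lambda>n. (1 / 2 :: real) ^ n)" by (rule summable_geometric) simp
  have E_meas: "ext U (E n) \<in> sets L" for n by (rule measure_internal(1)[OF E(1,2)])
  have "norm (L.prob (ext U (E n))) \<le> (1 / 2) ^ n" for n
    using measure_le_of_not_dense[OF E] by simp
  then have "summable (\<lambda>n. L.prob (ext U (E n)))" by (intro summable_comparison_test'[OF summ, of 0])
  then have AE_E: "AE y in L. eventually (\<lambda>n. y \<in> space L - ext U (E n)) sequentially"
    by (intro borel_cantelli_AE1 E_meas) (auto simp: less_top[symmetric])
  have compl: "- K n \<in> sets \<nu>" for n using K by (auto simp: sets_\<nu>)
  have F_meas: "st U -` (- K n) \<inter> ext U Y \<in> sets L" for n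
    using measurable_sets[OF st_measurable compl] by (simp add: space_loeb)
  have "norm (L.prob (st U -` (- K n) \<inter> ext U Y)) \<le> (1 / 2) ^ n" for n
    using emeasure_st[OF compl] small[of n] by (simp add: measure_def)
  then have "summable (\<lambda>n. L.prob (st U -` (- K n) \<inter> ext U Y))"
    by (intro summable_comparison_test'[OF summ, of 0])
  then have AE_K: "AE y in L. eventually (\<lambda>n. y \<in> space L - (st U -` (- K n) \<inter> ext U Y)) sequentially"
    by (intro borel_cantelli_AE1 F_meas) (auto simp: less_top[symmetric])
  have int_perm: "internal_permutation U Y T" by (rule star_perm_internal_permutation[OF T])
  have "AE y in L. near U (napp U T y) (star U (pt U (\<tau> (st U y))))"
    using AE_E AE_K AE_space
  proof eventually_elim
    case (elim y)
    then have y: "y \<in> ext U Y" by (simp add: space_loeb)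
    have "napp U T y \<in> ext U Y"
      using int_perm y by (auto simp: internal_permutation_def bij_betw_def)
    then have Ty: "nmem U (napp U T y) (star U points)" by (rule hyperfinite_points[OF hyperfinite_Y])
    have "star_pt_rel (\<lambda>a b. dist a b < e) (napp U T y) (star U (pt U (\<tau> (st U y))))" if e: "0 < e" for e :: real
    proof -
      (* T y is within 1 / (n + 1) of some \<tau> x with x in K n, and \<tau> x is within 1 / (n + 1) of \<tau> (st y). *)
      obtain m where m: "inverse (real (Suc m)) < e / 2"
        using reals_Archimedean[of "e / 2"] e by auto
      have "eventually (\<lambda>n. y \<in> space L - ext U (E n) \<and> y \<in> space L - (st U -` (- K n) \<inter> ext U Y) \<and> m \<le> n) sequentially"
        using elim(1,2) eventually_ge_at_top[of m] by eventually_elim auto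
      then obtain n where n: "y \<notin> ext U (E n)" "st U y \<in> K n" "m \<le> n"
        using y by (auto simp: eventually_sequentially)
      have "1 / real (Suc n) \<le> 1 / real (Suc m)" using n(3) by (intro divide_left_mono) auto
      then have small_n: "1 / real (Suc n) < e / 2" using m by (simp add: inverse_eq_divide)
      show ?thesis
      proof (rule star_pt_rel_at[OF _ good[OF y n(1)] near_st_Y_dist[OF y d[of n]]])
        fix u v assume "P n u v" and u: "dist u (st U y) < d n"
        then obtain x where x: "x \<in> K n" "dist u x < d n" "dist v (\<tau> x) < 1 / real (Suc n)"
          by (auto simp: P_def near_graph_def)
        have "dist x (st U y) < 2 * d n" using u x(2) dist_triangle3[of x "st U y" u] by linarith
        then have "dist (\<tau> x) (\<tau> (st U y)) < 1 / real (Suc n)" by (rule lusin[OF x(1) n(2)])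
        then show "dist v (\<tau> (st U y)) < e"
          using x(3) small_n dist_triangle[of v "\<tau> (st U y)" "\<tau> x"] by linarith
      qed
    qed
    then show ?case using near_iff[OF Ty star_pt_point] by blast
  qed
  then have "hf_approx_system U \<nu> \<tau> Y T" using approx int_perm by (simp add: hf_approx_system_def)
  then show ?thesis using trans by blast
qed

end

theorem theorem8:
  fixes U :: "('a::metric_space, 'u, 'w) universe"
    and \<nu> :: "'a measure"
    and \<tau> :: "'a \<Rightarrow> 'a"
    and Y :: 'w
  assumes "aleph1_saturated_universe U"
    and "compact (UNIV :: 'a set)"
    and "prob_space \<nu>" and "sets \<nu> = sets borel" and "nonatomic \<nu>"
    and "\<And>x r. 0 < r \<Longrightarrow> 0 < emeasure \<nu> (ball x r)"
    and "measure_preserving \<nu> \<nu> \<tau>"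
    and "hf_approx_space U \<nu> Y"
  shows "(\<exists>T. hf_approx_system U \<nu> \<tau> Y T) \<and>
         (\<exists>T. hf_approx_system U \<nu> \<tau> Y T \<and> transitive_permutation U Y T)"
proof -
  interpret prob_space \<nu> by fact
  interpret hyperfinite_approximation U \<nu> Y
    by unfold_locales (use assms in auto)
  show ?thesis using ex_transitive_approximation[OF assms(5,7)] by blast
qed

end
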